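(* Let $X$ be a Hilbert space with inner product $\langle\cdot,\cdot\rangle_X$, let $A:D_X(A)\subset X\to X$ and $\hat\Lambda:D_X(\hat\Lambda)\subset X\to X$ be linear operators, let $Y=(\mathrm{Ker}\,\hat\Lambda)^\perp$ in $X$, and let $\mathbb{Q}:X\to Y$ be the orthogonal projection. Assume: (1) $A$ is self-adjoint with compact resolvent and $\langle -Au,u\rangle_X\ge\|u\|_X^2$ for all $u\in D_X(A)$. (2)(i) $\hat\Lambda$ is densely defined, closed, and relatively compact with respect to $-A$ in $X$. (2)(ii) $\mathbb{Q}A\subset A\mathbb{Q}$, $D_X(A)\subset D_X(\hat\Lambda^* )$, and there is $C>0$ such that $|\langle\hat\Lambda u,u\rangle_X|+|\mathrm{Im}\langle -Au,\hat\Lambda u\rangle_X|\le C\langle -Au,u\rangle_X$ for all $u\in D_X(A)$. (2)(iii) There exist closed symmetric operators $B_1,B_2$ and constants $c_1,C>0$ such that $\hat\Lambda=B_1B_2$, $\mathrm{Ker}\,\hat\Lambda=\mathrm{Ker}\,B_2$, and $\|B_2u\|_X^2\le C\|(-A)^{1/2}u\|_X^2$ for $u\in D_X(A)$; $\langle u,B_2u\rangle_X\ge c_1\|u\|_X^2$ for $u\in D_X(A)\cap Y$; $\mathrm{Re}\langle -Au,B_2u\rangle_X\ge c_1\|(-A)^{1/2}u\|_X^2$ for $u\in D_X(A)\cap Y$. (3) There exist $C>0$, $\tau\in(0,\infty]$, $m_0\ge1$, and bounded functions $h_j:[m_0,\infty)\times\mathbb{R}\to[0,\infty)$, $j=1,2$,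 with $\lim_{m\to\infty}\sup_{\mu\in\mathbb{R}}h_j(m,\mu)=0$, such that: (3)(i) $\mathrm{Ker}\,\hat\Lambda\subset D_X(A)$. (3)(ii)(a) $\|B_2u\|_X\le C\|u\|_X$ for all $u\in X$. (3)(ii)(b) For all $\mu\in\mathbb{R}$ and $m\ge m_0$: $\|u\|_X^2\le C\big(m^2\|(\mu-\hat\Lambda)u\|_X^2+h_1^2(m,\mu)\|(-A)^{1/2}u\|_X^2\big)$ if $|\mu|\ge\tau$ and $u\in D_X(A)$; and $\|u\|_X^2\le C\big(m^2\|\mathbb{Q}(\mu-\hat\Lambda)u\|_X^2+h_1^2(m,\mu)\|(-A)^{1/2}u\|_X^2\big)$ if $|\mu|<\tau$ and $u\in D_X(A)\cap Y$. (3)(iii) There is a densely defined closed operator $B_3:D_X(B_3)\to X$ such that (a) $D_X((-A)^{1/2})\subset D_X(B_3)$ and $|\mathrm{Im}\langle Au,\hat\Lambda u\rangle_X|\le C\|(-A)^{1/2}u\|_X\|B_3u\|_X$ for $u\in D_X(A)$; and (b) for all $\mu\in\mathbb{R}$ and $m\ge m_0$: $\|B_3u\|_X^2\le C\big(m^2\|(\mu-\hat\Lambda)u\|_X^2+h_2^2(m,\mu)\|(-A)^{1/2}u\|_X^2\big)$ if $|\mu|\ge\tau$ and $u\in D_X(A)$; and $\|B_3u\|_X^2\le C\big(m^2\|\mathbb{Q}(\mu-\hat\Lambda)u\|_X^2+h_2^2(m,\mu)\|(-A)^{1/2}u\|_X^2\big)$ if $|\mu|<\tau$ and $u\in D_X(A)\cap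 Y$. For $\alpha\in\mathbb{R}$ let $L_\alpha=A-i\alpha\hat\Lambda$ with domain $D_X(A)$, and let $\mathbb{Q}L_\alpha$ denote the operator in $Y$ with domain $D_X(A)\cap Y$ given by $u\mapsto\mathbb{Q}Au-i\alpha\mathbb{Q}\hat\Lambda u$. Then for every $\alpha\in\mathbb{R}$ the set $\{\zeta\in\mathbb{C}:\mathrm{Re}\,\zeta\ge0\}$ is contained in the resolvent set of $L_\alpha$ in $X$ and in the resolvent set of $\mathbb{Q}L_\alpha$ in $Y$. Moreover, there exist $M_0>0$ and a constant $C'>0$, independent of $\alpha$ and $\lambda$, such that if $|\alpha|\ge M_0$ then for every $\lambda\in\mathbb{R}$ $$\|\mathbb{Q}(i\lambda+L_\alpha)^{-1}\|_{X\to X}=\|(i\lambda+\mathbb{Q}L_\alpha)^{-1}\|_{Y\to Y}\le C'\,F\big(\alpha,\tfrac{\lambda}{\alpha}\big),$$ where $$F(\alpha,\mu)=\inf_{m_1,m_2\ge m_0}\Big(\frac{m_1}{|\alpha|}+\frac{m_1^2m_2^2}{\alpha^2}+\frac{m_1^2h_2(m_2,\mu)}{|\alpha|}+h_1^2(m_1,\mu)\Big).$$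
   Context: $D_X(T)$ denotes the domain of an operator $T$ in $X$, and $\hat\Lambda^*$ is the adjoint of $\hat\Lambda$ in $X$. $\hat\Lambda$ relatively compact with respect to $-A$ means $D_X(A)\subset D_X(\hat\Lambda)$ and $\hat\Lambda$ is compact from $D_X(A)$ (graph norm) to $X$. $\mathbb{Q}A\subset A\mathbb{Q}$ means: if $u\in D_X(A)$ then $\mathbb{Q}u\in D_X(A)$ and $A\mathbb{Q}u=\mathbb{Q}Au$. $(-A)^{1/2}$ is the square root of the positive self-adjoint operator $-A$. The inequalities involving $B_2u$ include that the indicated $u$ belong to the domain of $B_2$. When $\tau=\infty$ the alternatives with $|\mu|\ge\tau$ are void. *)

theory Defs
  imports "HOL-Analysis.Analysis"
begin

text \<open>
  Complex Hilbert spaces. The real inner product of the superclass is the real part of the complex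
  one, so that the norm and topology are those of the library. The complex inner product is linear
  in its first and conjugate linear in its second argument.
\<close>

class complex_inner = real_inner +
  fixes scaleC :: "complex \<Rightarrow> 'a \<Rightarrow> 'a" (infixr "*\<^sub>C" 75)
    and cinner :: "'a \<Rightarrow> 'a \<Rightarrow> complex" ("\<langle>_, _\<rangle>")
  assumes scaleC_add_right: "a *\<^sub>C (x + y) = a *\<^sub>C x + a *\<^sub>C y"
    and scaleC_add_left: "(a + b) *\<^sub>C x = a *\<^sub>C x + b *\<^sub>C x"
    and scaleC_scaleC: "a *\<^sub>C (b *\<^sub>C x) = (a * b) *\<^sub>C x"
    and scaleR_eq_scaleC: "r *\<^sub>R x = complex_of_real r *\<^sub>C x"
    and cinner_commute: "\<langle>x, y\<rangle> = cnj \<langle>y, x\<rangle>"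
    and cinner_add_left: "\<langle>x + y, z\<rangle> = \<langle>x, z\<rangle> + \<langle>y, z\<rangle>"
    and cinner_scaleC_left: "\<langle>a *\<^sub>C x, y\<rangle> = a * \<langle>x, y\<rangle>"
    and inner_eq_Re_cinner: "inner x y = Re \<langle>x, y\<rangle>"

class chilbert_space = complex_inner + complete_space

text \<open>
  An operator \<open>T : D(T) \<subset> X \<rightarrow> X\<close> is a partial function. Thus \<open>dom T\<close> is its domain, equality of
  operators includes equality of domains, and \<open>\<circ>\<^sub>m\<close> is the product of operators on its
  natural domain.
\<close>

type_synonym 'a operator = "'a \<rightharpoonup> 'a"

abbreviation op_app :: "'a operator \<Rightarrow> 'a \<Rightarrow> 'a" (infixl "\<cdot>" 90)
  where "T \<cdot> u \<equiv> the (T u)"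

definition op_on :: "'a set \<Rightarrow> ('a \<Rightarrow> 'a) \<Rightarrow> 'a operator"
  where "op_on D f = (\<lambda>u. if u \<in> D then Some (f u) else None)"

definition linear_op :: "'a::complex_inner operator \<Rightarrow> bool" where
  "linear_op T \<longleftrightarrow> 0 \<in> dom T \<and>
     (\<forall>u\<in>dom T. \<forall>v\<in>dom T. u + v \<in> dom T \<and> T \<cdot> (u + v) = T \<cdot> u + T \<cdot> v) \<and>
     (\<forall>a. \<forall>u\<in>dom T. a *\<^sub>C u \<in> dom T \<and> T \<cdot> (a *\<^sub>C u) = a *\<^sub>C (T \<cdot> u))"

definition densely_defined :: "'a::complex_inner operator \<Rightarrow> bool"
  where "densely_defined T \<longleftrightarrow> closure (dom T) = UNIV"

definition closed_op :: "'a::complex_inner operator \<Rightarrow> bool"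
  where "closed_op T \<longleftrightarrow> closed (Map.graph T)"

definition op_ker :: "'a::complex_inner operator \<Rightarrow> 'a set"
  where "op_ker T = {u \<in> dom T. T \<cdot> u = 0}"

definition op_uminus :: "'a::complex_inner operator \<Rightarrow> 'a operator"
  where "op_uminus T = op_on (dom T) (\<lambda>u. - (T \<cdot> u))"

text \<open>The adjoint is meaningful for densely defined \<open>T\<close>, where the vector \<open>w\<close> below is unique.\<close>

definition adjoint_op :: "'a::complex_inner operator \<Rightarrow> 'a operator" where
  "adjoint_op T = op_on {v. \<exists>w. \<forall>u\<in>dom T. \<langle>T \<cdot> u, v\<rangle> = \<langle>u, w\<rangle>}
                        (\<lambda>v. THE w. \<forall>u\<in>dom T. \<langle>T \<cdot> u, v\<rangle> = \<langle>u, w\<rangle>)"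

definition self_adjoint :: "'a::complex_inner operator \<Rightarrow> bool"
  where "self_adjoint T \<longleftrightarrow> linear_op T \<and> densely_defined T \<and> adjoint_op T = T"

definition symmetric_op :: "'a::complex_inner operator \<Rightarrow> bool" where
  "symmetric_op T \<longleftrightarrow> linear_op T \<and> densely_defined T \<and>
     (\<forall>u\<in>dom T. \<forall>v\<in>dom T. \<langle>T \<cdot> u, v\<rangle> = \<langle>u, T \<cdot> v\<rangle>)"

text \<open>
  A positive self-adjoint operator on a Hilbert space has exactly one positive self-adjoint square
  root, so the choice below is no choice. For self-adjoint \<open>S\<close> the numbers \<open>\<langle>S u, u\<rangle>\<close> are real.
\<close>

definition op_sqrt :: "'a::complex_inner operator \<Rightarrow> 'a operator" where
  "op_sqrt T = (SOME S. self_adjoint S \<and> (\<forall>u\<in>dom S. 0 \<le> Re \<langle>S \<cdot> u, u\<rangle>) \<and> S \<circ>\<^sub>m S = T)"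

definition orth_compl :: "'a::complex_inner set \<Rightarrow> 'a set"
  where "orth_compl W = {u. \<forall>w\<in>W. \<langle>u, w\<rangle> = 0}"

definition orth_proj :: "'a::complex_inner set \<Rightarrow> 'a \<Rightarrow> 'a"
  where "orth_proj W u = (THE y. y \<in> W \<and> u - y \<in> orth_compl W)"

text \<open>
  The following notions are relative to a closed subspace \<open>W\<close>, the space in which \<open>T\<close> is considered
  as an operator; \<open>W = UNIV\<close> gives the whole space. The inverse is meaningful only for
  injective \<open>T\<close>.
\<close>

definition op_shift :: "complex \<Rightarrow> 'a::complex_inner operator \<Rightarrow> 'a operator"
  where "op_shift \<zeta> T = op_on (dom T) (\<lambda>u. \<zeta> *\<^sub>C u + T \<cdot> u)"

definition op_inverse :: "'a::complex_inner operator \<Rightarrow> 'a \<Rightarrow> 'a"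
  where "op_inverse T = inv_into (dom T) (\<lambda>u. T \<cdot> u)"

definition resolvent_set_in :: "'a::complex_inner set \<Rightarrow> 'a operator \<Rightarrow> complex set" where
  "resolvent_set_in W T = {\<zeta>. bij_betw (\<lambda>u. \<zeta> *\<^sub>C u - T \<cdot> u) (dom T) W \<and> dom T \<subseteq> W \<and>
     (\<exists>K. \<forall>u\<in>dom T. norm u \<le> K * norm (\<zeta> *\<^sub>C u - T \<cdot> u))}"

text \<open>As in \<^const>\<open>onorm\<close>, the vector 0 contributes the value 0.\<close>

definition onorm_in :: "'a::complex_inner set \<Rightarrow> ('a \<Rightarrow> 'a) \<Rightarrow> real"
  where "onorm_in W f = (SUP u\<in>W. norm (f u) / norm u)"

definition compact_resolvent :: "'a::complex_inner operator \<Rightarrow> bool" where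
  "compact_resolvent T \<longleftrightarrow> (\<exists>\<zeta>\<in>resolvent_set_in UNIV T.
     \<forall>S. bounded S \<longrightarrow> compact (closure (op_inverse (op_shift \<zeta> (op_uminus T)) ` S)))"

definition relatively_compact_op :: "'a::complex_inner operator \<Rightarrow> 'a operator \<Rightarrow> bool" where
  "relatively_compact_op K T \<longleftrightarrow> dom T \<subseteq> dom K \<and>
     (\<forall>S\<subseteq>dom T. (\<exists>b. \<forall>u\<in>S. norm u + norm (T \<cdot> u) \<le> b) \<longrightarrow>
        compact (closure ((\<lambda>u. K \<cdot> u) ` S)))"

definition L_op :: "'a::complex_inner operator \<Rightarrow> 'a operator \<Rightarrow> real \<Rightarrow> 'a operator" where
  "L_op A \<Lambda> \<alpha> = op_on (dom A) (\<lambda>u. A \<cdot> u - (\<i> * complex_of_real \<alpha>) *\<^sub>C (\<Lambda> \<cdot> u))"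

definition QL_op :: "'a::complex_inner operator \<Rightarrow> 'a operator \<Rightarrow> real \<Rightarrow> 'a operator" where
  "QL_op A \<Lambda> \<alpha> =
     (let Y = orth_compl (op_ker \<Lambda>); Q = orth_proj Y
      in op_on (dom A \<inter> Y)
           (\<lambda>u. Q (A \<cdot> u) - (\<i> * complex_of_real \<alpha>) *\<^sub>C Q (\<Lambda> \<cdot> u)))"

definition F_bound ::
  "real \<Rightarrow> (real \<Rightarrow> real \<Rightarrow> real) \<Rightarrow> (real \<Rightarrow> real \<Rightarrow> real) \<Rightarrow> real \<Rightarrow> real \<Rightarrow> real" where
  "F_bound m0 h1 h2 \<alpha> \<mu> = (INF (m1, m2) \<in> {m0..} \<times> {m0..}.
     m1 / \<bar>\<alpha>\<bar> + m1\<^sup>2 * m2\<^sup>2 / \<alpha>\<^sup>2 + m1\<^sup>2 * h2 m2 \<mu> / \<bar>\<alpha>\<bar> + (h1 m1 \<mu>)\<^sup>2)"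

text \<open>
  Bounded functions \<open>[m0, \<infinity>) \<times> \<real> \<rightarrow> [0, \<infinity>)\<close> tending to 0 as the first argument grows, uniformly
  in the second; the values for first arguments below \<open>m0\<close> are irrelevant.
\<close>

definition admissible_weight :: "real \<Rightarrow> (real \<Rightarrow> real \<Rightarrow> real) \<Rightarrow> bool" where
  "admissible_weight m0 h \<longleftrightarrow> (\<forall>m\<ge>m0. \<forall>\<mu>. 0 \<le> h m \<mu>) \<and> (\<exists>K. \<forall>m\<ge>m0. \<forall>\<mu>. h m \<mu> \<le> K) \<and>
     ((\<lambda>m. SUP \<mu>. h m \<mu>) \<longlongrightarrow> 0) at_top"

end

theory Submission
  imports Defs
begin

text \<open>
  Test \<open>(\<zeta> - Q L\<^sub>\<alpha>) u = f\<close> in \<open>Y\<close> against \<open>B2 u\<close>. Since \<open>\<langle>\<Lambda> u, B2 u\<rangle> = \<langle>B1 B2 u, B2 u\<rangle>\<close> is real, the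
  term with \<open>\<alpha>\<close> drops out of the real part, and for \<open>Re \<zeta> \<ge> 0\<close> this gives
  \<open>\<parallel>(-A)\<^sup>1\<^sup>/\<^sup>2 u\<parallel>\<^sup>2 \<le> K \<parallel>f\<parallel> \<parallel>u\<parallel>\<close> uniformly in \<open>\<alpha>\<close> and \<open>\<zeta>\<close>. Surjectivity on \<open>Y\<close> follows by the method of
  continuity in \<open>\<alpha>\<close>, starting from the self-adjoint operator \<open>\<zeta> - A\<close>; relative compactness bounds \<open>\<Lambda>\<close> by
  \<open>A\<close> with arbitrarily small relative bound. On \<open>X\<close> the operator is block triangular with respect to
  \<open>X = Y \<oplus> Ker \<Lambda>\<close>, with diagonal blocks \<open>\<zeta> - Q L\<^sub>\<alpha>\<close> and \<open>\<zeta> - A\<close>.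

  For the resolvent estimate on the imaginary axis, put \<open>v = (\<mu> - \<Lambda>) u\<close> with \<open>\<mu> = \<lambda> / \<alpha>\<close>. The
  equation reads \<open>f = A u + \<i> \<alpha> v\<close>, so the imaginary part of \<open>\<langle>f, v\<rangle>\<close> bounds \<open>\<bar>\<alpha>\<bar> \<parallel>v\<parallel>\<^sup>2\<close> by \<open>\<parallel>f\<parallel> \<parallel>v\<parallel>\<close> and
  the commutator term \<open>\<parallel>(-A)\<^sup>1\<^sup>/\<^sup>2 u\<parallel> \<parallel>B3 u\<parallel>\<close>. Inserting the hypotheses on \<open>\<parallel>u\<parallel>\<close> and \<open>\<parallel>B3 u\<parallel>\<close> closes
  the estimate. For \<open>\<bar>\<mu>\<bar> \<ge> \<tau>\<close> these are available without the projection \<open>Q\<close> only; there \<open>u\<close> is replaced by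
  the solution of the equation on \<open>X\<close>, whose kernel component is controlled once \<open>\<bar>\<alpha>\<bar>\<close> is large.
\<close>

section \<open>Complex inner product spaces\<close>

lemma scaleC_one [simp]: "1 *\<^sub>C (x::'a::complex_inner) = x"
  using scaleR_eq_scaleC[of 1 x] by simp

lemma scaleC_zero_left [simp]: "0 *\<^sub>C (x::'a::complex_inner) = 0"
  using scaleR_eq_scaleC[of 0 x] by simp

lemma scaleC_zero_right [simp]: "a *\<^sub>C (0::'a::complex_inner) = 0"
  using scaleC_add_right[of a 0 "0::'a"] by simp

lemma scaleC_minus1 [simp]: "(- 1) *\<^sub>C (x::'a::complex_inner) = - x"
  using scaleR_eq_scaleC[of "-1" x] by simp

lemma scaleC_minus_right [simp]: "a *\<^sub>C (- (x::'a::complex_inner)) = - (a *\<^sub>C x)"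
  using scaleC_add_right[of a x "-x"] by (simp add: eq_neg_iff_add_eq_0 add.commute)

lemma scaleC_minus_left [simp]: "(- a) *\<^sub>C (x::'a::complex_inner) = - (a *\<^sub>C x)"
  using scaleC_scaleC[of "-1" a x] by simp

lemma scaleC_diff_right: "a *\<^sub>C ((x::'a::complex_inner) - y) = a *\<^sub>C x - a *\<^sub>C y"
  using scaleC_add_right[of a x "-y"] by simp

lemma scaleC_scaleR: "a *\<^sub>C (r *\<^sub>R (x::'a::complex_inner)) = r *\<^sub>R (a *\<^sub>C x)"
  by (simp add: scaleR_eq_scaleC scaleC_scaleC mult.commute)

lemma cinner_minus_left [simp]: "\<langle>- x, y\<rangle> = - \<langle>x, y\<rangle>"
  using cinner_scaleC_left[of "-1" x y] by simp

lemma cinner_zero_left [simp]: "\<langle>0, y\<rangle> = 0"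
  using cinner_scaleC_left[of 0 0 y] by simp

lemma cinner_diff_left: "\<langle>x - y, z\<rangle> = \<langle>x, z\<rangle> - \<langle>y, z\<rangle>"
  using cinner_add_left[of x "-y" z] by simp

lemma cinner_add_right: "\<langle>z, x + y\<rangle> = \<langle>z, x\<rangle> + \<langle>z, y\<rangle>"
  using cinner_commute[of z "x+y"] cinner_commute[of z x] cinner_commute[of z y]
  by (simp add: cinner_add_left)

lemma cinner_scaleC_right: "\<langle>x, a *\<^sub>C y\<rangle> = cnj a * \<langle>x, y\<rangle>"
  using cinner_commute[of x "a *\<^sub>C y"] cinner_commute[of x y]
  by (simp add: cinner_scaleC_left)

lemma cinner_minus_right [simp]: "\<langle>x, - y\<rangle> = - \<langle>x, y\<rangle>"
  using cinner_scaleC_right[of x "-1" y] by simp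

lemma cinner_zero_right [simp]: "\<langle>x, 0\<rangle> = 0"
  using cinner_scaleC_right[of x 0 0] by simp

lemma cinner_diff_right: "\<langle>z, x - y\<rangle> = \<langle>z, x\<rangle> - \<langle>z, y\<rangle>"
  using cinner_add_right[of z x "-y"] by simp

lemma cinner_self: "\<langle>x, x\<rangle> = complex_of_real ((norm x)\<^sup>2)"
proof (rule complex_eqI)
  show "Re \<langle>x, x\<rangle> = Re (complex_of_real ((norm x)\<^sup>2))"
    using inner_eq_Re_cinner[of x x] by (simp add: power2_norm_eq_inner)
  show "Im \<langle>x, x\<rangle> = Im (complex_of_real ((norm x)\<^sup>2))"
    using arg_cong[OF cinner_commute[of x x], of Im] by simp
qed

lemma norm_scaleC [simp]: "norm (a *\<^sub>C (x::'a::complex_inner)) = cmod a * norm x"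
proof -
  have "complex_of_real ((norm (a *\<^sub>C x))\<^sup>2) = complex_of_real ((cmod a * norm x)\<^sup>2)"
    unfolding cinner_self[symmetric] cinner_scaleC_left cinner_scaleC_right
    by (simp add: cinner_self complex_norm_square power_mult_distrib mult.assoc[symmetric]
        del: of_real_power)
  then have "(norm (a *\<^sub>C x))\<^sup>2 = (cmod a * norm x)\<^sup>2"
    using of_real_eq_iff by blast
  then show ?thesis
    by (simp add: power2_eq_iff_nonneg)
qed

text \<open>Rotating \<open>x\<close> by the conjugate phase of the inner product makes that product
  real, so the real Cauchy-Schwarz inequality applies. As \<open>sgn 0 = 0\<close>, the factor
  \<open>b\<close> may vanish, hence only \<open>cmod b \<le> 1\<close>.\<close>

lemma cmod_cinner_le: "cmod \<langle>x, y\<rangle> \<le> norm x * norm y"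
proof -
  define b where "b = cnj (sgn \<langle>x, y\<rangle>)"
  have b: "cmod b \<le> 1" by (simp add: b_def norm_sgn)
  have "b * \<langle>x, y\<rangle> = complex_of_real (cmod \<langle>x, y\<rangle>)"
  proof (cases "\<langle>x, y\<rangle> = 0")
    case False
    then show ?thesis
      using complex_norm_square[of "\<langle>x, y\<rangle>"]
      by (simp add: b_def sgn_eq field_simps power2_eq_square)
  qed simp
  then have "cmod \<langle>x, y\<rangle> = Re \<langle>b *\<^sub>C x, y\<rangle>"
    by (simp add: cinner_scaleC_left)
  also have "\<dots> \<le> norm (b *\<^sub>C x) * norm y"
    using norm_cauchy_schwarz[of "b *\<^sub>C x" y] by (simp add: inner_eq_Re_cinner)
  also have "\<dots> \<le> norm x * norm y"
    using b by (simp add: mult_left_le_one_le mult_right_mono)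
  finally show ?thesis .
qed

lemma bounded_linear_scaleC: "bounded_linear (\<lambda>x::'a::complex_inner. a *\<^sub>C x)"
  by (rule bounded_linear_intro[where K = "cmod a"])
    (auto simp: scaleC_add_right scaleC_scaleR mult.commute)

lemma bounded_linear_cinner_left: "bounded_linear (\<lambda>x. \<langle>x, y\<rangle>)"
  by (rule bounded_linear_intro[where K = "norm y"])
    (auto simp: cinner_add_left scaleR_eq_scaleC cinner_scaleC_left cmod_cinner_le scaleR_conv_of_real)

lemma bounded_linear_cinner_right: "bounded_linear (\<lambda>y. \<langle>x, y\<rangle>)"
  by (rule bounded_linear_intro[where K = "norm x"])
    (auto simp: cinner_add_right scaleR_eq_scaleC cinner_scaleC_right cmod_cinner_le
      scaleR_conv_of_real mult.commute[of _ "norm x"])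

lemmas tendsto_scaleC = bounded_linear.tendsto[OF bounded_linear_scaleC]
lemmas tendsto_cinner_left = bounded_linear.tendsto[OF bounded_linear_cinner_left]
lemmas tendsto_cinner_right = bounded_linear.tendsto[OF bounded_linear_cinner_right]

lemma cinner_dense_zero:
  fixes w :: "'a::complex_inner"
  assumes "closure S = UNIV" "\<And>s. s \<in> S \<Longrightarrow> \<langle>s, w\<rangle> = 0"
  shows "w = 0"
proof -
  obtain s where s: "\<And>n. s n \<in> S" "s \<longlonglongrightarrow> w"
    using assms(1) closure_sequential[of w S] by auto
  have "(\<lambda>n. \<langle>s n, w\<rangle>) \<longlonglongrightarrow> \<langle>w, w\<rangle>"
    by (rule tendsto_cinner_left[OF s(2)])
  moreover have "(\<lambda>n. \<langle>s n, w\<rangle>) = (\<lambda>n. 0)" using s assms(2) by auto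
  ultimately have "\<langle>w, w\<rangle> = 0" using LIMSEQ_unique by (metis tendsto_const)
  then show ?thesis by (simp add: cinner_self)
qed

section \<open>Closed subspaces and orthogonal decomposition\<close>

definition csubspace :: "'a::complex_inner set \<Rightarrow> bool" where
  "csubspace W \<longleftrightarrow> 0 \<in> W \<and> (\<forall>u\<in>W. \<forall>v\<in>W. u + v \<in> W) \<and> (\<forall>a. \<forall>u\<in>W. a *\<^sub>C u \<in> W)"

lemma csubspace_imp_subspace: "csubspace W \<Longrightarrow> subspace W"
  by (auto simp: csubspace_def subspace_def scaleR_eq_scaleC)

lemma csubspaceD:
  assumes "csubspace W"
  shows "0 \<in> W" "u \<in> W \<Longrightarrow> v \<in> W \<Longrightarrow> u + v \<in> W" "u \<in> W \<Longrightarrow> v \<in> W \<Longrightarrow> u - v \<in> W"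
    "u \<in> W \<Longrightarrow> - u \<in> W" "u \<in> W \<Longrightarrow> a *\<^sub>C u \<in> W" "u \<in> W \<Longrightarrow> r *\<^sub>R u \<in> W"
  using assms subspace_diff[OF csubspace_imp_subspace[OF assms]]
    subspace_neg[OF csubspace_imp_subspace[OF assms]]
  by (auto simp: csubspace_def scaleR_eq_scaleC)

lemma closed_orth_compl: "closed (orth_compl W)"
proof -
  have "orth_compl W = (\<Inter>w\<in>W. {u. \<langle>u, w\<rangle> = 0})" by (auto simp: orth_compl_def)
  moreover have "closed {u. \<langle>u, w\<rangle> = 0}" for w :: 'a
    using continuous_closed_vimage[of "{0}" "\<lambda>u. \<langle>u, w\<rangle>"]
      bounded_linear_cinner_left[of w, THEN linear_continuous_at]
    by (simp add: vimage_def)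
  ultimately show ?thesis by auto
qed

lemma csubspace_orth_compl: "csubspace (orth_compl W)"
  by (auto simp: csubspace_def orth_compl_def cinner_add_left cinner_scaleC_left)

lemma csubspace_Int: "csubspace V \<Longrightarrow> csubspace W \<Longrightarrow> csubspace (V \<inter> W)"
  by (auto simp: csubspace_def)

text \<open>Parallelogram law: midpoints of a minimizing sequence stay in \<open>W\<close>, so they
  cannot beat the infimum \<open>d\<close>, and this makes the sequence Cauchy. Squared distances
  are minimized because the law is linear in them.\<close>

lemma nearest_point_exists:
  fixes W :: "'a::{real_inner,complete_space} set"
  assumes "closed W" "subspace W"
  shows "\<exists>y\<in>W. \<forall>w\<in>W. norm (x - y) \<le> norm (x - w)"
proof -
  define d where "d = (INF w\<in>W. (norm (x - w))\<^sup>2)"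
  have bdd: "bdd_below ((\<lambda>w. (norm (x - w))\<^sup>2) ` W)" by (rule bdd_belowI[of _ 0]) auto
  have ne: "W \<noteq> {}" using assms subspace_0 by blast
  have d: "d \<le> (norm (x - w))\<^sup>2" if "w \<in> W" for w
    unfolding d_def by (rule cINF_lower[OF bdd that])
  have "\<exists>w\<in>W. (norm (x - w))\<^sup>2 < d + 1 / Suc n" for n
    using cInf_lessD[of "(\<lambda>w. (norm (x - w))\<^sup>2) ` W" "d + 1 / Suc n"] ne
    by (auto simp: d_def)
  then obtain s where s: "\<And>n. s n \<in> W" "\<And>n. (norm (x - s n))\<^sup>2 < d + 1 / Suc n" by metis
  have par: "(norm (s m - s n))\<^sup>2 \<le> 2 / Suc m + 2 / Suc n" for m n
  proof -
    have "(1/2) *\<^sub>R (s m + s n) \<in> W"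
      using assms s by (simp add: subspace_add subspace_scale)
    from d[OF this] have "4 * d \<le> (norm (2 *\<^sub>R (x - (1/2) *\<^sub>R (s m + s n))))\<^sup>2"
      by (simp only: norm_scaleR power_mult_distrib) simp
    also have "2 *\<^sub>R (x - (1/2) *\<^sub>R (s m + s n)) = (x - s m) + (x - s n)"
      by (simp add: algebra_simps scaleR_2)
    finally have "4 * d \<le> (norm ((x - s m) + (x - s n)))\<^sup>2" .
    moreover have "(norm ((x - s m) + (x - s n)))\<^sup>2 + (norm (s m - s n))\<^sup>2
        = 2 * (norm (x - s m))\<^sup>2 + 2 * (norm (x - s n))\<^sup>2"
      by (simp add: power2_norm_eq_inner inner_simps inner_commute algebra_simps)
    ultimately show ?thesis using s(2)[of m] s(2)[of n] by simp
  qed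
  have "Cauchy s"
  proof (rule CauchyI)
    fix e :: real assume e: "0 < e"
    obtain N :: nat where N: "4 / e\<^sup>2 < real N" using reals_Archimedean2 by blast
    show "\<exists>M. \<forall>m\<ge>M. \<forall>n\<ge>M. norm (s m - s n) < e"
    proof (intro exI allI impI)
      fix m n assume mn: "N \<le> m" "N \<le> n"
      have N0: "0 < real N" using N e by (meson divide_pos_pos less_trans zero_less_numeral zero_less_power)
      have "2 / Suc m \<le> 2 / N" "2 / Suc n \<le> 2 / N" using mn N0 by (auto intro!: divide_left_mono)
      then have "(norm (s m - s n))\<^sup>2 \<le> 4 / N" using par[of m n] by simp
      also have "4 / N < e\<^sup>2" using N N0 e by (simp add: field_simps)
      finally show "norm (s m - s n) < e" using e by (simp add: power_less_imp_less_base)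
    qed
  qed
  then obtain y where y: "s \<longlonglongrightarrow> y" using Cauchy_convergent convergentD by blast
  have yW: "y \<in> W" using closed_sequentially[OF assms(1)] s(1) y by blast
  have "(\<lambda>n. (norm (x - s n))\<^sup>2) \<longlonglongrightarrow> (norm (x - y))\<^sup>2" by (intro tendsto_intros y)
  moreover have "(\<lambda>n. d + 1 / Suc n) \<longlonglongrightarrow> d + 0"
    by (intro tendsto_intros LIMSEQ_inverse_real_of_nat[unfolded inverse_eq_divide])
  ultimately have "(norm (x - y))\<^sup>2 \<le> d"
    using s(2) by (intro LIMSEQ_le) (auto intro: less_imp_le)
  then have "norm (x - y) \<le> norm (x - w)" if "w \<in> W" for w
    using order_trans[OF _ d[OF that]] power2_le_imp_le norm_ge_zero by blast
  then show ?thesis using yW by blast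
qed

lemma orth_decomposition:
  fixes W :: "'a::chilbert_space set"
  assumes "closed W" "csubspace W"
  shows "\<exists>y\<in>W. x - y \<in> orth_compl W"
proof -
  obtain y where y: "y \<in> W" "\<And>w. w \<in> W \<Longrightarrow> norm (x - y) \<le> norm (x - w)"
    using nearest_point_exists[OF assms(1) csubspace_imp_subspace[OF assms(2)]] by blast
  have "\<langle>x - y, w\<rangle> = 0" if w: "w \<in> W" for w
  proof (rule ccontr)
    assume nz: "\<langle>x - y, w\<rangle> \<noteq> 0"
    \<comment> \<open>Coefficient of the projection of \<open>x - y\<close> onto \<open>w\<close>:
      moving \<open>y\<close> by \<open>t *\<^sub>C w\<close> lowers the squared distance by
      \<open>(cmod \<langle>x - y, w\<rangle>)\<^sup>2 / (norm w)\<^sup>2\<close>, against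
      minimality.\<close>
    define t where "t = \<langle>x - y, w\<rangle> / complex_of_real ((norm w)\<^sup>2)"
    have w0: "norm w \<noteq> 0" using nz by auto
    have "y + t *\<^sub>C w \<in> W" by (intro csubspaceD[OF assms(2)] y(1) w)
    from y(2)[OF this] have "(norm (x - y))\<^sup>2 \<le> (norm ((x - y) - t *\<^sub>C w))\<^sup>2"
      unfolding diff_diff_eq by (rule power_mono) (rule norm_ge_zero)
    also have "complex_of_real ((norm ((x - y) - t *\<^sub>C w))\<^sup>2)
       = complex_of_real ((norm (x - y))\<^sup>2) - \<langle>x - y, w\<rangle> * cnj \<langle>x - y, w\<rangle> / complex_of_real ((norm w)\<^sup>2)"
    proof -
      have alg: "N - cnj (z / n) * z - (z / n * cnj z - z / n * (cnj (z / n) * n)) = N - z * cnj z / n"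
        if "cnj n = n" "n \<noteq> 0" for N z n :: complex
        using that by (simp add: field_simps)
      have "\<langle>(x - y) - t *\<^sub>C w, (x - y) - t *\<^sub>C w\<rangle> = \<langle>x - y, x - y\<rangle> - cnj t * \<langle>x - y, w\<rangle>
          - (t * cnj \<langle>x - y, w\<rangle> - t * (cnj t * \<langle>w, w\<rangle>))"
        unfolding cinner_commute[of w "x - y", symmetric]
        by (simp only: cinner_diff_left[of "x - y"] cinner_diff_right[of _ "x - y"]
            cinner_scaleC_left cinner_scaleC_right) (simp add: right_diff_distrib mult.left_commute)
      then show ?thesis
        unfolding cinner_self t_def using w0
        by (subst (asm) alg) auto
    qed
    then have "(norm ((x - y) - t *\<^sub>C w))\<^sup>2 = (norm (x - y))\<^sup>2 - (cmod \<langle>x - y, w\<rangle>)\<^sup>2 / (norm w)\<^sup>2"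
      by (simp add: complex_norm_square[symmetric] flip: of_real_power of_real_divide of_real_diff
           del: of_real_power of_real_divide of_real_diff)
    finally show False using nz w0 by (simp add: divide_le_0_iff)
  qed
  then show ?thesis using y by (auto simp: orth_compl_def)
qed

section \<open>Unbounded operators\<close>

instance chilbert_space \<subseteq> banach ..

lemma dom_op_on [simp]: "dom (op_on D f) = D"
  by (auto simp: op_on_def dom_def)

lemma op_on_apply [simp]: "u \<in> D \<Longrightarrow> op_on D f \<cdot> u = f u"
  by (simp add: op_on_def)

lemma op_eqI:
  assumes "dom S = dom T" "\<And>u. u \<in> dom T \<Longrightarrow> S \<cdot> u = T \<cdot> u"
  shows "S = T"
proof
  fix u show "S u = T u"
    using assms by (cases "u \<in> dom T") (auto simp: domIff, metis domIff option.expand)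
qed

lemma linear_op_csubspace: "linear_op T \<Longrightarrow> csubspace (dom T)"
  by (auto simp: linear_op_def csubspace_def)

lemma linear_op_add: "linear_op T \<Longrightarrow> u \<in> dom T \<Longrightarrow> v \<in> dom T \<Longrightarrow> T \<cdot> (u + v) = T \<cdot> u + T \<cdot> v"
  by (auto simp: linear_op_def)

lemma linear_op_scaleC: "linear_op T \<Longrightarrow> u \<in> dom T \<Longrightarrow> T \<cdot> (a *\<^sub>C u) = a *\<^sub>C (T \<cdot> u)"
  by (auto simp: linear_op_def)

lemma linear_op_scaleR: "linear_op T \<Longrightarrow> u \<in> dom T \<Longrightarrow> T \<cdot> (r *\<^sub>R u) = r *\<^sub>R (T \<cdot> u)"
  by (simp add: scaleR_eq_scaleC linear_op_scaleC)

lemma linear_op_zero: "linear_op T \<Longrightarrow> T \<cdot> 0 = 0"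
  using linear_op_scaleC[of T 0 0] by (simp add: linear_op_def)

lemma linear_op_minus: "linear_op T \<Longrightarrow> u \<in> dom T \<Longrightarrow> T \<cdot> (- u) = - (T \<cdot> u)"
  using linear_op_scaleC[of T u "-1"] by simp

lemma linear_op_diff: "linear_op T \<Longrightarrow> u \<in> dom T \<Longrightarrow> v \<in> dom T \<Longrightarrow> T \<cdot> (u - v) = T \<cdot> u - T \<cdot> v"
  using linear_op_add[of T u "-v"] linear_op_minus[of T v] csubspaceD(4)[OF linear_op_csubspace, of T v]
  by simp

text \<open>Density of \<open>dom T\<close> makes the representing vector unique, which evaluates
  the definite description in \<open>adjoint_op\<close>.\<close>

lemma adjoint_op_eqI:
  assumes "densely_defined T" "\<And>u. u \<in> dom T \<Longrightarrow> \<langle>T \<cdot> u, v\<rangle> = \<langle>u, w\<rangle>"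
  shows "v \<in> dom (adjoint_op T)" "adjoint_op T \<cdot> v = w"
proof -
  show v: "v \<in> dom (adjoint_op T)" using assms(2) by (auto simp: adjoint_op_def)
  have "(THE w. \<forall>u\<in>dom T. \<langle>T \<cdot> u, v\<rangle> = \<langle>u, w\<rangle>) = w"
  proof (rule the_equality)
    fix w' assume w': "\<forall>u\<in>dom T. \<langle>T \<cdot> u, v\<rangle> = \<langle>u, w'\<rangle>"
    have "w' - w = 0"
      using assms w' by (intro cinner_dense_zero[of "dom T"])
        (auto simp: densely_defined_def cinner_diff_right)
    then show "w' = w" by simp
  qed (use assms in auto)
  then show "adjoint_op T \<cdot> v = w"
    using v by (simp add: adjoint_op_def)
qed

lemma adjoint_op_cinner:
  assumes "densely_defined T" "v \<in> dom (adjoint_op T)" "u \<in> dom T"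
  shows "\<langle>T \<cdot> u, v\<rangle> = \<langle>u, adjoint_op T \<cdot> v\<rangle>"
proof -
  obtain w where w: "\<And>u. u \<in> dom T \<Longrightarrow> \<langle>T \<cdot> u, v\<rangle> = \<langle>u, w\<rangle>"
    using assms(2) by (auto simp: adjoint_op_def)
  show ?thesis using adjoint_op_eqI(2)[OF assms(1) w] w[OF assms(3)] by simp
qed

lemma self_adjoint_symmetric:
  "self_adjoint T \<Longrightarrow> u \<in> dom T \<Longrightarrow> v \<in> dom T \<Longrightarrow> \<langle>T \<cdot> u, v\<rangle> = \<langle>u, T \<cdot> v\<rangle>"
  using adjoint_op_cinner[of T v u] by (simp add: self_adjoint_def)

text \<open>Turns a weak identity into membership in the domain; in this way self-adjointness, as
  opposed to symmetry, enters the later arguments.\<close>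

lemma self_adjoint_maximal:
  assumes "self_adjoint T" "\<And>u. u \<in> dom T \<Longrightarrow> \<langle>T \<cdot> u, v\<rangle> = \<langle>u, w\<rangle>"
  shows "v \<in> dom T" "T \<cdot> v = w"
  using adjoint_op_eqI[OF _ assms(2)] assms(1) by (simp_all add: self_adjoint_def)

lemma self_adjoint_limit:
  assumes T: "self_adjoint T" and u: "\<And>n. u n \<in> dom T" "u \<longlonglongrightarrow> v" "(\<lambda>n. T \<cdot> u n) \<longlonglongrightarrow> w"
  shows "v \<in> dom T" "T \<cdot> v = w"
proof -
  have "\<langle>T \<cdot> x, v\<rangle> = \<langle>x, w\<rangle>" if x: "x \<in> dom T" for x
  proof (rule LIMSEQ_unique)
    show "(\<lambda>n. \<langle>T \<cdot> x, u n\<rangle>) \<longlonglongrightarrow> \<langle>T \<cdot> x, v\<rangle>" by (rule tendsto_cinner_right[OF u(2)])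
    show "(\<lambda>n. \<langle>T \<cdot> x, u n\<rangle>) \<longlonglongrightarrow> \<langle>x, w\<rangle>"
      unfolding self_adjoint_symmetric[OF T x u(1)] by (rule tendsto_cinner_right[OF u(3)])
  qed
  from self_adjoint_maximal[OF T this] show "v \<in> dom T" "T \<cdot> v = w" by blast+
qed

section \<open>Solvability for coercive self-adjoint operators\<close>

lemma shift_lower_bound:
  assumes "(norm u)\<^sup>2 \<le> Re \<langle>v, u\<rangle>" "Re \<zeta> \<ge> 0"
  shows "norm u \<le> norm (\<zeta> *\<^sub>C u + v)"
proof -
  have "(norm u)\<^sup>2 \<le> Re \<langle>\<zeta> *\<^sub>C u + v, u\<rangle>"
    using assms mult_nonneg_nonneg[of "Re \<zeta>" "(norm u)\<^sup>2"]
    by (simp add: cinner_add_left cinner_scaleC_left cinner_self del: of_real_power mult_nonneg_nonneg)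
  also have "\<dots> \<le> norm (\<zeta> *\<^sub>C u + v) * norm u"
    using cmod_cinner_le complex_Re_le_cmod order_trans by blast
  finally have "norm u * norm u \<le> norm (\<zeta> *\<^sub>C u + v) * norm u" by (simp add: power2_eq_square)
  then show ?thesis
    by (cases "u = 0") (auto simp: mult_le_cancel_right)
qed

text \<open>The range is closed because of the lower bound and the closedness of \<open>T\<close>. A
  vector orthogonal to the range solves the adjoint equation weakly, hence lies in
  \<open>dom T\<close>, and coercivity forces it to vanish.\<close>

lemma self_adjoint_shift_surj:
  fixes T :: "'a::chilbert_space operator"
  assumes T: "self_adjoint T" and coer: "\<And>u. u \<in> dom T \<Longrightarrow> (norm u)\<^sup>2 \<le> Re \<langle>T \<cdot> u, u\<rangle>"
    and \<zeta>: "Re \<zeta> \<ge> 0"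
  shows "\<exists>u\<in>dom T. \<zeta> *\<^sub>C u + T \<cdot> u = f"
proof -
  define g where "g u = \<zeta> *\<^sub>C u + T \<cdot> u" for u
  have lin: "linear_op T" using T by (simp add: self_adjoint_def)
  note sub = csubspaceD[OF linear_op_csubspace[OF lin]]
  have g_add: "g (u + v) = g u + g v" if "u \<in> dom T" "v \<in> dom T" for u v
    using linear_op_add[OF lin that] by (simp add: g_def scaleC_add_right)
  have g_diff: "g (u - v) = g u - g v" if "u \<in> dom T" "v \<in> dom T" for u v
    using linear_op_diff[OF lin that] by (simp add: g_def scaleC_diff_right)
  have g_scale: "g (a *\<^sub>C u) = a *\<^sub>C g u" if "u \<in> dom T" for a u
    using linear_op_scaleC[OF lin that] by (simp add: g_def scaleC_add_right scaleC_scaleC mult.commute)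
  have bound: "norm u \<le> norm (g u)" if "u \<in> dom T" for u
    unfolding g_def by (rule shift_lower_bound[OF coer[OF that] \<zeta>])
  have "csubspace (g ` dom T)"
    unfolding csubspace_def
  proof (intro conjI ballI allI)
    show "0 \<in> g ` dom T" using sub(1) linear_op_zero[OF lin] by (force simp: g_def)
    show "x + y \<in> g ` dom T" if "x \<in> g ` dom T" "y \<in> g ` dom T" for x y
      using that sub(2) by (elim imageE) (metis g_add imageI)
    show "a *\<^sub>C x \<in> g ` dom T" if "x \<in> g ` dom T" for a x
      using that sub(5) by (elim imageE) (metis g_scale imageI)
  qed
  moreover have "closed (g ` dom T)"
    unfolding closed_sequential_limits
  proof (intro allI impI, elim conjE)
    fix s l assume s: "\<forall>n. s n \<in> g ` dom T" and l: "s \<longlonglongrightarrow> l"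
    have "\<exists>u. \<forall>n. u n \<in> dom T \<and> s n = g (u n)"
      by (rule choice) (use s in blast)
    then obtain u where u: "\<And>n. u n \<in> dom T" "\<And>n. s n = g (u n)" by blast
    have "Cauchy u"
    proof (rule CauchyI)
      fix e :: real assume "0 < e"
      with LIMSEQ_imp_Cauchy[OF l, THEN CauchyD] obtain M where
        M: "\<And>m n. m \<ge> M \<Longrightarrow> n \<ge> M \<Longrightarrow> norm (s m - s n) < e" by blast
      have "norm (u m - u n) \<le> norm (s m - s n)" for m n
        using bound[OF sub(3), OF u(1) u(1), of m n] by (simp add: g_diff u)
      then show "\<exists>M. \<forall>m\<ge>M. \<forall>n\<ge>M. norm (u m - u n) < e"
        using M by (meson le_less_trans)
    qed
    then obtain v where v: "u \<longlonglongrightarrow> v" using Cauchy_convergent convergentD by blast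
    have "(\<lambda>n. s n - \<zeta> *\<^sub>C u n) \<longlonglongrightarrow> l - \<zeta> *\<^sub>C v" by (intro tendsto_diff l tendsto_scaleC v)
    then have "(\<lambda>n. T \<cdot> u n) \<longlonglongrightarrow> l - \<zeta> *\<^sub>C v" by (simp add: u(2) g_def)
    from self_adjoint_limit[OF T u(1) v this] show "l \<in> g ` dom T"
      by (intro image_eqI[of _ _ v]) (auto simp: g_def)
  qed
  ultimately obtain y where y: "y \<in> g ` dom T" "f - y \<in> orth_compl (g ` dom T)"
    using orth_decomposition by blast
  define v where "v = f - y"
  have "\<langle>T \<cdot> u, v\<rangle> = \<langle>u, - (cnj \<zeta> *\<^sub>C v)\<rangle>" if "u \<in> dom T" for u
  proof -
    have "\<langle>v, g u\<rangle> = 0" using y(2) that by (auto simp: v_def orth_compl_def)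
    then have "\<langle>g u, v\<rangle> = 0" using cinner_commute[of "g u" v] by simp
    then show ?thesis
      by (simp add: g_def cinner_add_left cinner_scaleC_left cinner_scaleC_right eq_neg_iff_add_eq_0 add.commute)
  qed
  from self_adjoint_maximal[OF T this] have v: "v \<in> dom T" "T \<cdot> v = - (cnj \<zeta> *\<^sub>C v)" by blast+
  from coer[OF v(1)] have "(norm v)\<^sup>2 \<le> - (Re \<zeta> * (norm v)\<^sup>2)"
    by (simp add: v(2) cinner_scaleC_left cinner_self del: of_real_power)
  also have "\<dots> \<le> 0" using \<zeta> by simp
  finally have "v = 0" by simp
  then show ?thesis using y(1) by (auto simp: v_def g_def)
qed

section \<open>Square roots of positive operators\<close>

text \<open>The coefficients of \<open>sqrt (1 - x)\<close>. They are absolutely summable with total mass at most 2,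
  hence \<open>sqrt R = (\<Sum>n. sqrt_coeff n *\<^sub>R (1 - R) ^ n)\<close> converges whenever \<open>1 - R\<close> is a contraction. All but
  the first coefficient are negative and the partial sums are nonnegative, whence positivity.\<close>

definition sqrt_coeff :: "nat \<Rightarrow> real" where
  "sqrt_coeff n = (1/2 gchoose n) * (-1) ^ n"

lemma gbinomial_Suc_mult: "(a::real) gchoose Suc n = (a gchoose n) * (a - real n) / (real n + 1)"
  by (simp add: gbinomial_prod_rev field_simps)

lemma sqrt_coeff_0 [simp]: "sqrt_coeff 0 = 1"
  by (simp add: sqrt_coeff_def)

text \<open>The alternating partial sums for the exponent 1/2 collapse to a single signed
  coefficient for the exponent -1/2, and these arise from 1 by multiplication with positive
  ratios.\<close>

lemma sqrt_coeff_partial_sum: "(\<Sum>k\<le>n. sqrt_coeff k) \<ge> 0"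
proof -
  have "0 \<le> (-1) ^ n * (- 1/2 gchoose n :: real)"
  proof (induction n)
    case (Suc n)
    have "(-1) ^ Suc n * (- 1/2 gchoose Suc n :: real)
      = ((-1) ^ n * (- 1/2 gchoose n)) * ((real n + 1/2) / (real n + 1))"
      by (simp add: gbinomial_Suc_mult field_simps)
    also have "\<dots> \<ge> 0" by (rule mult_nonneg_nonneg[OF Suc]) auto
    finally show ?case .
  qed simp
  moreover have "(\<Sum>k\<le>n. sqrt_coeff k) = (-1) ^ n * (- 1/2 gchoose n :: real)"
    using gbinomial_sum_lower_neg[of "1/2::real" n] by (simp add: sqrt_coeff_def)
  ultimately show ?thesis by simp
qed

lemma sqrt_coeff_nonpos: "sqrt_coeff (Suc n) \<le> 0"
proof (induction n)
  case (Suc n)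
  have "sqrt_coeff (Suc (Suc n)) = sqrt_coeff (Suc n) * ((real n + 1/2) / (real n + 2))"
    by (simp add: sqrt_coeff_def gbinomial_Suc_mult[of _ "Suc n"] field_simps)
  also have "\<dots> \<le> 0" using Suc by (intro mult_nonpos_nonneg) auto
  finally show ?case .
qed (simp add: sqrt_coeff_def)

lemma sqrt_coeff_abs_sum: "(\<Sum>k<n. \<bar>sqrt_coeff k\<bar>) \<le> 2"
proof (cases n)
  case (Suc m)
  have "(\<Sum>k<n. \<bar>sqrt_coeff k\<bar>) = 1 + (\<Sum>k<m. \<bar>sqrt_coeff (Suc k)\<bar>)"
    by (simp add: Suc sum.lessThan_Suc_shift del: sum.lessThan_Suc)
  also have "(\<Sum>k<m. \<bar>sqrt_coeff (Suc k)\<bar>) = - (\<Sum>k<m. sqrt_coeff (Suc k))"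
    by (simp add: sqrt_coeff_nonpos sum_negf)
  also have "(\<Sum>k<m. sqrt_coeff (Suc k)) = (\<Sum>k\<le>m. sqrt_coeff k) - 1"
    using sum.lessThan_Suc_shift[of sqrt_coeff m]
    by (simp add: lessThan_Suc_atMost del: sum.lessThan_Suc)
  finally show ?thesis using sqrt_coeff_partial_sum[of m] by simp
qed simp

lemma summable_sqrt_coeff: "summable (\<lambda>n. \<bar>sqrt_coeff n\<bar>)"
  by (rule bounded_imp_summable[where B = 2])
    (use sqrt_coeff_abs_sum[of "Suc n" for n] in \<open>auto simp: lessThan_Suc_atMost\<close>)

text \<open>Vandermonde's identity reduces the convolution to binomial coefficients of exponent 1:
  the square of the series is \<open>1 - x\<close>.\<close>

lemma sqrt_coeff_convolution:
  "(\<Sum>i\<le>n. sqrt_coeff i * sqrt_coeff (n - i)) = (if n = 0 then 1 else if n = 1 then -1 else 0)"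
proof -
  have "(\<Sum>i\<le>n. sqrt_coeff i * sqrt_coeff (n - i))
    = (\<Sum>i=0..n. (1/2 gchoose i) * (1/2 gchoose (n - i))) * (-1) ^ n"
    unfolding sum_distrib_right atMost_atLeast0
    by (intro sum.cong refl) (auto simp: sqrt_coeff_def power_add[symmetric])
  also have "\<dots> = (1 gchoose n) * (-1) ^ n"
    by (simp add: gbinomial_Vandermonde)
  also have "(1::real) gchoose n = of_nat (1 choose n)"
    by (simp add: binomial_gbinomial)
  also have "\<dots> * (-1) ^ n = (if n = 0 then 1 else if n = 1 then -1 else 0)"
    by (auto simp: binomial_eq_0)
  finally show ?thesis .
qed

text \<open>The last assumption says that \<open>0 \<le> R \<le> 1\<close>, in the form needed for \<open>1 - R\<close> to be a contraction.\<close>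

lemma bounded_sqrt_exists:
  fixes R :: "'a::chilbert_space \<Rightarrow> 'a"
  assumes add: "\<And>x y. R (x + y) = R x + R y" and scale: "\<And>a x. R (a *\<^sub>C x) = a *\<^sub>C R x"
    and sym: "\<And>x y. \<langle>R x, y\<rangle> = \<langle>x, R y\<rangle>"
    and le: "\<And>x. (norm (R x))\<^sup>2 \<le> Re \<langle>R x, x\<rangle>"
  shows "\<exists>G. (\<forall>x y. G (x + y) = G x + G y) \<and> (\<forall>a x. G (a *\<^sub>C x) = a *\<^sub>C G x) \<and>
    (\<forall>x y. \<langle>G x, y\<rangle> = \<langle>x, G y\<rangle>) \<and> (\<forall>x. 0 \<le> Re \<langle>G x, x\<rangle>) \<and> (\<forall>x. G (G x) = R x)"
proof -
  define K where "K x = x - R x" for x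
  define p where "p n = K ^^ n" for n :: nat
  have K_norm: "norm (K x) \<le> norm x" for x
  proof -
    have "(norm (K x))\<^sup>2 = (norm x)\<^sup>2 - 2 * inner (R x) x + (norm (R x))\<^sup>2"
      by (simp add: K_def power2_norm_eq_inner inner_simps inner_commute)
    also have "\<dots> \<le> (norm x)\<^sup>2"
      using le[of x] zero_le_power2[of "norm (R x)"] unfolding inner_eq_Re_cinner by linarith
    finally show ?thesis using power2_le_imp_le norm_ge_zero by blast
  qed
  have p_add: "p n (x + y) = p n x + p n y" for n x y
    by (induction n) (simp_all add: p_def K_def add)
  have p_scale: "p n (a *\<^sub>C x) = a *\<^sub>C p n x" for n a x
    by (induction n) (simp_all add: p_def K_def scale scaleC_diff_right)
  have p_sym: "\<langle>p n x, y\<rangle> = \<langle>x, p n y\<rangle>" for n x y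
  proof (induction n arbitrary: x y)
    case (Suc n)
    have "\<langle>p (Suc n) x, y\<rangle> = \<langle>p n x, K y\<rangle>"
      by (simp add: p_def K_def cinner_diff_left cinner_diff_right sym)
    also have "\<dots> = \<langle>x, p (Suc n) y\<rangle>"
      unfolding Suc by (simp add: p_def funpow_swap1)
    finally show ?case .
  qed (simp add: p_def)
  have p_norm: "norm (p n x) \<le> norm x" for n x
    by (induction n) (auto simp: p_def intro: order_trans[OF K_norm])
  have p_p: "p m (p n x) = p (m + n) x" for m n x
    by (simp add: p_def funpow_add)
  have p_bl: "bounded_linear (p n)" for n
    by (rule bounded_linear_intro[where K = 1]) (auto simp: p_add p_scale scaleR_eq_scaleC p_norm)
  define s where "s N x = (\<Sum>n<N. sqrt_coeff n *\<^sub>R p n x)" for N x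
  define G where "G x = (\<Sum>n. sqrt_coeff n *\<^sub>R p n x)" for x
  have term_le: "norm (sqrt_coeff n *\<^sub>R p n x) \<le> \<bar>sqrt_coeff n\<bar> * norm x" for n x
    using p_norm[of n x] by (simp add: mult_left_mono)
  have summ: "summable (\<lambda>n. sqrt_coeff n *\<^sub>R p n x)" for x
    by (rule summable_comparison_test[OF _ summable_mult2[OF summable_sqrt_coeff, of "norm x"]])
      (use term_le in blast)
  have sG: "(\<lambda>N. s N x) \<longlonglongrightarrow> G x" for x
    unfolding s_def G_def by (rule summable_LIMSEQ[OF summ])
  have s_bl: "bounded_linear (s N)" for N
    unfolding s_def by (intro bounded_linear_sum bounded_linear_const_scaleR p_bl)
  have s_norm: "norm (s N x) \<le> 2 * norm x" for N x
  proof -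
    have "norm (s N x) \<le> (\<Sum>n<N. \<bar>sqrt_coeff n\<bar> * norm x)"
      unfolding s_def by (rule order_trans[OF norm_sum sum_mono[OF term_le]])
    also have "\<dots> \<le> 2 * norm x"
      unfolding sum_distrib_right[symmetric] by (intro mult_right_mono sqrt_coeff_abs_sum) auto
    finally show ?thesis .
  qed
  have G_add: "G (x + y) = G x + G y" for x y
  proof (rule LIMSEQ_unique[OF sG])
    show "(\<lambda>N. s N (x + y)) \<longlonglongrightarrow> G x + G y"
      using tendsto_add[OF sG sG, of x y] by (simp add: s_def p_add scaleR_right_distrib sum.distrib)
  qed
  have G_scale: "G (a *\<^sub>C x) = a *\<^sub>C G x" for a x
  proof (rule LIMSEQ_unique[OF sG])
    have "s N (a *\<^sub>C x) = a *\<^sub>C s N x" for N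
      unfolding s_def linear_sum[OF bounded_linear.linear[OF bounded_linear_scaleC]]
      by (simp add: p_scale scaleC_scaleR)
    then show "(\<lambda>N. s N (a *\<^sub>C x)) \<longlonglongrightarrow> a *\<^sub>C G x"
      using tendsto_scaleC[OF sG[of x], of a] by simp
  qed
  have s_sym: "\<langle>s N x, y\<rangle> = \<langle>x, s N y\<rangle>" for N x y
    unfolding s_def linear_sum[OF bounded_linear.linear[OF bounded_linear_cinner_left]]
      linear_sum[OF bounded_linear.linear[OF bounded_linear_cinner_right]]
    by (simp add: scaleR_eq_scaleC cinner_scaleC_left cinner_scaleC_right p_sym)
  have G_sym: "\<langle>G x, y\<rangle> = \<langle>x, G y\<rangle>" for x y
    using LIMSEQ_unique[OF tendsto_cinner_left[OF sG[of x], of y]]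
      tendsto_cinner_right[OF sG[of y], of x] by (simp add: s_sym)
  have s_pos: "0 \<le> Re \<langle>s N x, x\<rangle>" if N: "N > 0" for N x
  proof -
    obtain M where M: "N = Suc M" using N gr0_implies_Suc by blast
    have bd: "\<bar>Re \<langle>p n x, x\<rangle>\<bar> \<le> (norm x)\<^sup>2" for n
    proof -
      have "\<bar>Re \<langle>p n x, x\<rangle>\<bar> \<le> norm (p n x) * norm x"
        by (rule order_trans[OF abs_Re_le_cmod cmod_cinner_le])
      also have "\<dots> \<le> (norm x)\<^sup>2"
        unfolding power2_eq_square by (rule mult_right_mono[OF p_norm norm_ge_zero])
      finally show ?thesis .
    qed
    \<comment> \<open>The term for 0 is an equality; all later coefficients are nonpositive, so the
      upper bound \<open>bd\<close> on the quadratic forms turns into a lower bound after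
      multiplication.\<close>
    have "sqrt_coeff n * (norm x)\<^sup>2 \<le> sqrt_coeff n * Re \<langle>p n x, x\<rangle>" for n
    proof (cases n)
      case 0
      then show ?thesis by (simp add: p_def cinner_self del: of_real_power)
    next
      case (Suc k)
      then show ?thesis using bd[of n] sqrt_coeff_nonpos[of k] by (intro mult_left_mono_neg) auto
    qed
    then have "(\<Sum>n<N. sqrt_coeff n) * (norm x)\<^sup>2 \<le> (\<Sum>n<N. sqrt_coeff n * Re \<langle>p n x, x\<rangle>)"
      unfolding sum_distrib_right by (rule sum_mono)
    moreover have "Re \<langle>s N x, x\<rangle> = (\<Sum>n<N. sqrt_coeff n * Re \<langle>p n x, x\<rangle>)"
      unfolding s_def linear_sum[OF bounded_linear.linear[OF bounded_linear_cinner_left]]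
      by (simp add: scaleR_eq_scaleC cinner_scaleC_left)
    moreover have "0 \<le> (\<Sum>n<N. sqrt_coeff n) * (norm x)\<^sup>2"
      using sqrt_coeff_partial_sum[of M] by (simp add: M lessThan_Suc_atMost del: sum.lessThan_Suc)
    ultimately show ?thesis by simp
  qed
  have G_pos: "0 \<le> Re \<langle>G x, x\<rangle>" for x
  proof (rule LIMSEQ_le_const)
    show "(\<lambda>N. Re \<langle>s N x, x\<rangle>) \<longlonglongrightarrow> Re \<langle>G x, x\<rangle>"
      by (intro tendsto_Re tendsto_cinner_left sG)
    show "\<exists>N. \<forall>n\<ge>N. 0 \<le> Re \<langle>s n x, x\<rangle>"
      using s_pos by (intro exI[of _ 1]) auto
  qed
  have GG: "G (G x) = R x" for x
  proof -
    have "(\<lambda>N. norm (s N (s N x) - G (G x))) \<longlonglongrightarrow> 0"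
    proof (rule tendsto_sandwich[of "\<lambda>_. 0", OF _ _ tendsto_const])
      have "norm (s N (s N x) - G (G x)) \<le> 2 * norm (s N x - G x) + norm (s N (G x) - G (G x))" for N
      proof -
        have "s N (s N x) - G (G x) = s N (s N x - G x) + (s N (G x) - G (G x))"
          by (simp add: linear_diff[OF bounded_linear.linear[OF s_bl]])
        then show ?thesis
          using norm_triangle_ineq s_norm add_right_mono order_trans by metis
      qed
      then show "\<forall>\<^sub>F N in sequentially. norm (s N (s N x) - G (G x))
          \<le> 2 * norm (s N x - G x) + norm (s N (G x) - G (G x))" by simp
      have "(\<lambda>N. 2 * norm (s N x - G x) + norm (s N (G x) - G (G x))) \<longlonglongrightarrow> 2 * norm (G x - G x) + norm (G (G x) - G (G x))"
        by (intro tendsto_intros sG)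
      then show "(\<lambda>N. 2 * norm (s N x - G x) + norm (s N (G x) - G (G x))) \<longlonglongrightarrow> 0" by simp
    qed simp
    then have lim1: "(\<lambda>N. s N (s N x)) \<longlonglongrightarrow> G (G x)"
      using tendsto_norm_zero_iff LIM_zero_iff by blast
    \<comment> \<open>Expand the double sum over the square \<open>?S1\<close>. Its triangle
      \<open>?S2\<close> sums to \<open>R x\<close> exactly, and the rest is dominated by the
      corresponding difference for the absolute coefficients, whose two sums tend to the same Cauchy
      product.\<close>
    let ?b = "\<lambda>n. \<bar>sqrt_coeff n\<bar>"
    let ?S1 = "\<lambda>N::nat. {..<N} \<times> {..<N}" and ?S2 = "\<lambda>N::nat. {(i,j). i + j < N}"
    let ?g = "\<lambda>(i,j). (sqrt_coeff i * sqrt_coeff j) *\<^sub>R p (i + j) x"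
    let ?h = "\<lambda>(i,j). ?b i * ?b j"
    have sub: "?S2 N \<subseteq> ?S1 N" for N by auto
    have fin: "finite (?S1 N)" for N by simp
    have ss: "s N (s N x) = sum ?g (?S1 N)" for N
    proof -
      have "s N (s N x) = (\<Sum>i<N. sqrt_coeff i *\<^sub>R (\<Sum>j<N. sqrt_coeff j *\<^sub>R p (i + j) x))"
        unfolding s_def linear_sum[OF bounded_linear.linear[OF p_bl]]
          linear_cmul[OF bounded_linear.linear[OF p_bl]] p_p ..
      also have "\<dots> = sum ?g (?S1 N)"
        by (simp add: scaleR_right.sum sum.cartesian_product)
      finally show ?thesis .
    qed
    \<comment> \<open>By the convolution formula only the powers 0 and 1 survive, leaving
      \<open>x - K x\<close>; hence the restriction to \<open>N \<ge> 2\<close>.\<close>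
    have tri: "sum ?g (?S2 N) = R x" if "N \<ge> 2" for N
    proof -
      have "sum ?g (?S2 N) = (\<Sum>k<N. (\<Sum>i\<le>k. sqrt_coeff i * sqrt_coeff (k - i)) *\<^sub>R p k x)"
        unfolding sum.triangle_reindex scaleR_sum_left by (intro sum.cong refl) auto
      also have "\<dots> = (\<Sum>k<2. (\<Sum>i\<le>k. sqrt_coeff i * sqrt_coeff (k - i)) *\<^sub>R p k x)"
        using that by (intro sum.mono_neutral_right) (auto simp: sqrt_coeff_convolution)
      also have "\<dots> = R x"
        by (simp add: sqrt_coeff_convolution numeral_2_eq_2 p_def K_def del: One_nat_def)
      finally show ?thesis .
    qed
    have "(\<lambda>N. sum ?h (?S1 N) - sum ?h (?S2 N)) \<longlonglongrightarrow> (\<Sum>n. ?b n) * (\<Sum>n. ?b n) - (\<Sum>n. ?b n) * (\<Sum>n. ?b n)"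
    proof (rule tendsto_diff)
      show "(\<lambda>N. sum ?h (?S1 N)) \<longlonglongrightarrow> (\<Sum>n. ?b n) * (\<Sum>n. ?b n)"
        using tendsto_mult[OF summable_LIMSEQ summable_LIMSEQ, OF summable_sqrt_coeff summable_sqrt_coeff]
        by (simp add: sum_product sum.cartesian_product)
      show "(\<lambda>N. sum ?h (?S2 N)) \<longlonglongrightarrow> (\<Sum>n. ?b n) * (\<Sum>n. ?b n)"
        unfolding sum.triangle_reindex
        using Cauchy_product_sums[of ?b ?b] summable_sqrt_coeff by (simp add: sums_def)
    qed
    then have lim0: "(\<lambda>N. sum ?h (?S1 N) - sum ?h (?S2 N)) \<longlonglongrightarrow> 0" by simp
    have "norm (s N (s N x) - R x) \<le> (sum ?h (?S1 N) - sum ?h (?S2 N)) * norm x" if N: "N \<ge> 2" for N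
    proof -
      have "s N (s N x) - R x = sum ?g (?S1 N - ?S2 N)"
        unfolding ss tri[OF N, symmetric] by (rule sum_diff[OF fin sub, symmetric])
      also have "norm \<dots> \<le> (\<Sum>q\<in>?S1 N - ?S2 N. ?h q * norm x)"
      proof (rule order_trans[OF norm_sum sum_mono])
        fix q :: "nat \<times> nat"
        obtain i j where q: "q = (i, j)" by fastforce
        show "norm (?g q) \<le> ?h q * norm x"
          using p_norm[of "i + j" x] by (simp add: q abs_mult mult_left_mono)
      qed
      also have "\<dots> = (sum ?h (?S1 N) - sum ?h (?S2 N)) * norm x"
        unfolding sum_distrib_right[symmetric] by (subst sum_diff[OF fin sub]) simp
      finally show ?thesis .
    qed
    then have "\<forall>\<^sub>F N in sequentially. norm (s N (s N x) - R x)
        \<le> (sum ?h (?S1 N) - sum ?h (?S2 N)) * norm x"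
      using eventually_ge_at_top by (rule eventually_mono[rotated])
    then have "(\<lambda>N. norm (s N (s N x) - R x)) \<longlonglongrightarrow> 0"
      by (rule tendsto_sandwich[of "\<lambda>_. 0", OF always_eventually _ tendsto_const tendsto_mult_left_zero[OF lim0], rotated])
        simp
    then have "(\<lambda>N. s N (s N x)) \<longlonglongrightarrow> R x"
      using tendsto_norm_zero_iff LIM_zero_iff by blast
    with lim1 show ?thesis by (rule LIMSEQ_unique)
  qed
  show ?thesis
    using G_add G_scale G_sym G_pos GG by blast
qed

text \<open>Coercivity makes the inverse \<open>R\<close> of \<open>T\<close> an everywhere defined
  symmetric operator between 0 and 1. Its bounded root \<open>G\<close> exists by
  \<open>bounded_sqrt_exists\<close>, and the inverse \<open>S\<close> of \<open>G\<close> is the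
  root of \<open>T\<close>.\<close>

lemma op_sqrt_exists:
  fixes T :: "'a::chilbert_space operator"
  assumes T: "self_adjoint T" and coer: "\<And>u. u \<in> dom T \<Longrightarrow> (norm u)\<^sup>2 \<le> Re \<langle>T \<cdot> u, u\<rangle>"
  shows "\<exists>S. self_adjoint S \<and> (\<forall>u\<in>dom S. 0 \<le> Re \<langle>S \<cdot> u, u\<rangle>) \<and> S \<circ>\<^sub>m S = T"
proof -
  have lin: "linear_op T" and dense: "closure (dom T) = UNIV"
    using T by (simp_all add: self_adjoint_def densely_defined_def)
  note sub = csubspaceD[OF linear_op_csubspace[OF lin]]
  define R where "R f = (SOME u. u \<in> dom T \<and> T \<cdot> u = f)" for f
  have "\<exists>u. u \<in> dom T \<and> T \<cdot> u = f" for f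
    using self_adjoint_shift_surj[OF T coer, of 0 f] by auto
  then have R: "R f \<in> dom T" "T \<cdot> R f = f" for f
    unfolding R_def by (metis (mono_tags, lifting) someI_ex)+
  have inj: "u = v" if "u \<in> dom T" "v \<in> dom T" "T \<cdot> u = T \<cdot> v" for u v
    using shift_lower_bound[OF coer[OF sub(3)[OF that(1,2)]], of 0] linear_op_diff[OF lin that(1,2)] that(3)
    by simp
  have RT: "R (T \<cdot> u) = u" if "u \<in> dom T" for u
    by (rule inj) (use R that in auto)
  have R_add: "R (x + y) = R x + R y" for x y
    by (rule inj) (use R sub in \<open>auto simp: linear_op_add[OF lin]\<close>)
  have R_scale: "R (a *\<^sub>C x) = a *\<^sub>C R x" for a x
    by (rule inj) (use R sub in \<open>auto simp: linear_op_scaleC[OF lin]\<close>)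
  have R_sym: "\<langle>R x, y\<rangle> = \<langle>x, R y\<rangle>" for x y
    using self_adjoint_symmetric[OF T R(1) R(1), of x y] by (simp add: R(2))
  have R_le: "(norm (R x))\<^sup>2 \<le> Re \<langle>R x, x\<rangle>" for x
    using coer[OF R(1), of x] cinner_commute[of "R x" x] by (simp add: R(2))
  obtain G where G: "\<And>x y. G (x + y) = G x + G y" "\<And>a x. G (a *\<^sub>C x) = a *\<^sub>C G x"
    "\<And>x y. \<langle>G x, y\<rangle> = \<langle>x, G y\<rangle>" "\<And>x. 0 \<le> Re \<langle>G x, x\<rangle>" "\<And>x. G (G x) = R x"
    using bounded_sqrt_exists[OF R_add R_scale R_sym R_le] by blast
  have G_inj: "inj G"
    by (rule inj_on_inverseI[where g = "\<lambda>x. T \<cdot> G x"]) (simp add: G(5) R(2))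
  define S where "S = op_on (range G) (inv G)"
  have dS: "dom S = range G" by (simp add: S_def)
  have SG: "S \<cdot> G x = x" for x by (simp add: S_def inv_f_f[OF G_inj])
  have linS: "linear_op S"
    unfolding linear_op_def dS
  proof (intro conjI ballI allI)
    show "0 \<in> range G" using G(2)[of 0 0] by (metis rangeI scaleC_zero_left)
    show "u + v \<in> range G" "S \<cdot> (u + v) = S \<cdot> u + S \<cdot> v" if "u \<in> range G" "v \<in> range G" for u v
      using that by (auto simp: G(1)[symmetric] SG)
    show "a *\<^sub>C u \<in> range G" "S \<cdot> (a *\<^sub>C u) = a *\<^sub>C (S \<cdot> u)" if "u \<in> range G" for a u
      using that by (auto simp: G(2)[symmetric] SG)
  qed
  have domT: "dom T = range (\<lambda>x. G (G x))"
    using R(1) RT by (auto simp: G(5)) (metis domI rangeI)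
  have denseS: "densely_defined S"
  proof -
    have "dom T \<subseteq> range G" unfolding domT by auto
    from closure_mono[OF this] show ?thesis by (auto simp: densely_defined_def dS dense)
  qed
  have "adjoint_op S = S"
  proof (rule op_eqI)
    have adj: "v \<in> dom (adjoint_op S) \<and> adjoint_op S \<cdot> v = S \<cdot> v" if v: "v \<in> dom S" for v
    proof -
      obtain y where y: "v = G y" using v dS by auto
      have "\<langle>S \<cdot> u, v\<rangle> = \<langle>u, S \<cdot> v\<rangle>" if "u \<in> dom S" for u
        using that by (auto simp: dS SG y G(3))
      from adjoint_op_eqI[OF denseS this] show ?thesis by blast
    qed
    show "dom (adjoint_op S) = dom S"
    proof
      show "dom (adjoint_op S) \<subseteq> dom S"
      proof
        fix v assume v: "v \<in> dom (adjoint_op S)"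
        \<comment> \<open>The elements of \<open>dom S\<close> are the \<open>G x\<close> with
          arbitrary \<open>x\<close>, so testing the adjoint relation on them identifies
          \<open>v\<close> as an element of the range of \<open>G\<close>.\<close>
        have "\<langle>x, v - G (adjoint_op S \<cdot> v)\<rangle> = 0" for x
          using adjoint_op_cinner[OF denseS v, of "G x"] by (simp add: dS SG G(3) cinner_diff_right)
        from this[of "v - G (adjoint_op S \<cdot> v)"] have "v = G (adjoint_op S \<cdot> v)"
          by (simp add: cinner_self)
        then show "v \<in> dom S" unfolding dS by (rule range_eqI)
      qed
    qed (use adj in blast)
    show "adjoint_op S \<cdot> v = S \<cdot> v" if "v \<in> dom S" for v using adj[OF that] by blast
  qed
  moreover have "0 \<le> Re \<langle>S \<cdot> u, u\<rangle>" if u: "u \<in> dom S" for u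
  proof -
    obtain x where "u = G x" using u dS by auto
    then show ?thesis using G(4)[of x] G(3)[of x x] by (simp add: SG)
  qed
  moreover have "S \<circ>\<^sub>m S = T"
  proof
    fix u
    show "(S \<circ>\<^sub>m S) u = T u"
    proof (cases "u \<in> dom T")
      case True
      then obtain x where x: "u = G (G x)" unfolding domT by auto
      have "S u = Some (G x)" "S (G x) = Some x"
        using SG[of "G x"] SG[of x] by (simp_all add: S_def op_on_def x)
      moreover have "T u = Some x"
        using True R(2)[of x] by (simp add: x G(5) domIff) (metis option.expand option.sel option.distinct(1))
      ultimately show ?thesis by (simp add: map_comp_def)
    next
      case False
      have "(S \<circ>\<^sub>m S) u = None"
      proof (rule ccontr)
        assume "(S \<circ>\<^sub>m S) u \<noteq> None"
        then obtain y where y: "S u = Some y" "S y \<noteq> None" by (auto simp: map_comp_def split: option.splits)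
        then have "u \<in> range G" "y \<in> range G" "y = inv G u"
          by (auto simp: S_def op_on_def split: if_splits)
        then have "u \<in> range (\<lambda>x. G (G x))" by (auto simp: inv_f_f[OF G_inj])
        with False domT show False by blast
      qed
      with False show ?thesis by (simp add: domIff)
    qed
  qed
  ultimately show ?thesis
    using linS denseS unfolding self_adjoint_def by blast
qed

text \<open>Any operator that the choice in \<open>op_sqrt\<close> may return is symmetric and
  squares to \<open>T\<close>; one factor moved across the inner product gives the norm
  identity.\<close>

lemma norm_op_sqrt:
  fixes T :: "'a::chilbert_space operator"
  assumes T: "self_adjoint T" and coer: "\<And>u. u \<in> dom T \<Longrightarrow> (norm u)\<^sup>2 \<le> Re \<langle>T \<cdot> u, u\<rangle>"
    and u: "u \<in> dom T"
  shows "u \<in> dom (op_sqrt T)" "(norm (op_sqrt T \<cdot> u))\<^sup>2 = Re \<langle>T \<cdot> u, u\<rangle>"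
proof -
  define S where "S = op_sqrt T"
  have "self_adjoint S \<and> (\<forall>u\<in>dom S. 0 \<le> Re \<langle>S \<cdot> u, u\<rangle>) \<and> S \<circ>\<^sub>m S = T"
    unfolding S_def op_sqrt_def using op_sqrt_exists[OF T coer] by (rule someI_ex)
  then have S: "self_adjoint S" "S \<circ>\<^sub>m S = T" by blast+
  obtain y z where yz: "S u = Some y" "S y = Some z" "T u = Some z"
    using u S(2)[symmetric] by (auto simp: map_comp_def split: option.splits)
  then have d: "u \<in> dom S" "y \<in> dom S" by auto
  then show "u \<in> dom (op_sqrt T)" by (simp add: S_def)
  have "\<langle>S \<cdot> y, u\<rangle> = \<langle>y, S \<cdot> u\<rangle>" by (rule self_adjoint_symmetric[OF S(1) d(2,1)])
  then show "(norm (op_sqrt T \<cdot> u))\<^sup>2 = Re \<langle>T \<cdot> u, u\<rangle>"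
    using yz by (simp add: S_def[symmetric] cinner_self del: of_real_power)
qed

section \<open>Bounds by category, continuity and compactness\<close>

text \<open>Uniform boundedness by Baire: the closed sets \<open>E n\<close> cover the space, so one
  of them contains a ball, and testing at its centre and at a boundary point in direction
  \<open>w\<close> bounds \<open>norm w\<close>.\<close>

lemma weakly_bounded_imp_bounded:
  fixes W :: "'a::chilbert_space set"
  assumes "\<And>x. \<exists>b. \<forall>w\<in>W. cmod \<langle>x, w\<rangle> \<le> b"
  shows "\<exists>K\<ge>0. \<forall>w\<in>W. norm w \<le> K"
proof -
  define E where "E n = {x. \<forall>w\<in>W. cmod \<langle>x, w\<rangle> \<le> real n}" for n
  have cl: "closed (E n)" for n
  proof -
    have "E n = (\<Inter>w\<in>W. {x. cmod \<langle>x, w\<rangle> \<le> real n})" by (auto simp: E_def)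
    moreover have "closed {x. cmod \<langle>x, w\<rangle> \<le> real n}" for w :: 'a
      by (intro closed_Collect_le continuous_on_norm continuous_on_const linear_continuous_on
          bounded_linear_cinner_left)
    ultimately show ?thesis by auto
  qed
  have cover: "(\<Union>n. E n) = UNIV"
  proof (intro equalityI subset_UNIV subsetI)
    fix x
    obtain b where b: "\<forall>w\<in>W. cmod \<langle>x, w\<rangle> \<le> b" using assms by blast
    obtain n :: nat where "b \<le> real n" using real_arch_simple by blast
    with b have "x \<in> E n" by (force simp: E_def)
    then show "x \<in> (\<Union>n. E n)" by blast
  qed
  have "\<exists>n. interior (E n) \<noteq> {}"
  proof (rule ccontr)
    assume "\<nexists>n. interior (E n) \<noteq> {}"
    then have "Met_TC.mtopology interior_of \<Union>(range E) = {}"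
      by (intro Met_TC.metric_Baire_category_alt) (auto simp: cl complete_UNIV)
    then show False using cover by simp
  qed
  then obtain n x where "x \<in> interior (E n)" by blast
  then obtain r where r: "r > 0" "cball x r \<subseteq> E n"
    by (meson mem_interior_cball)
  have "norm w \<le> 2 * real n / r" if w: "w \<in> W" for w
  proof (cases "w = 0")
    case False
    define y where "y = x + (r / norm w) *\<^sub>R w"
    have "x \<in> E n" "y \<in> E n" using r False by (auto simp: y_def dist_norm intro!: subsetD[OF r(2)])
    then have "cmod \<langle>y - x, w\<rangle> \<le> 2 * real n"
      using w norm_triangle_ineq4[of "\<langle>y, w\<rangle>" "\<langle>x, w\<rangle>"] by (force simp: E_def cinner_diff_left)
    also have "\<langle>y - x, w\<rangle> = complex_of_real (r * norm w)"
      using False by (simp add: y_def scaleR_eq_scaleC cinner_scaleC_left cinner_self power2_eq_square)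
    finally show ?thesis using r by (simp add: field_simps norm_mult)
  qed (use r in simp)
  then show ?thesis using r by (intro exI[of _ "2 * real n / r"]) auto
qed

text \<open>Solvability at a parameter \<open>r\<close> extends to all \<open>t\<close> with
  \<open>\<bar>t - r\<bar> * k \<le> 1/2\<close> by a contraction argument. As \<open>k\<close> is
  uniform up to \<open>\<bar>s\<bar>\<close>, finitely many steps lead from 0 to
  \<open>s\<close>.\<close>

lemma continuity_method:
  fixes T V :: "'a::banach \<Rightarrow> 'a"
  assumes Y: "closed Y" "subspace Y" and D: "subspace D"
    and T: "\<And>u. u \<in> D \<Longrightarrow> T u \<in> Y" "\<And>u v. u \<in> D \<Longrightarrow> v \<in> D \<Longrightarrow> T (u - v) = T u - T v"
    and V: "\<And>u. u \<in> D \<Longrightarrow> V u \<in> Y" "\<And>u v. u \<in> D \<Longrightarrow> v \<in> D \<Longrightarrow> V (u - v) = V u - V v"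
    and bound: "\<And>t u. \<bar>t\<bar> \<le> \<bar>s\<bar> \<Longrightarrow> u \<in> D \<Longrightarrow> norm (V u) \<le> k * norm (T u + t *\<^sub>R V u)"
    and surj: "Y \<subseteq> T ` D"
  shows "Y \<subseteq> (\<lambda>u. T u + s *\<^sub>R V u) ` D"
proof -
  define P where "P t \<longleftrightarrow> (\<forall>y\<in>Y. \<exists>u\<in>D. T u + t *\<^sub>R V u = y)" for t
  have step: "P t" if r: "P r" "\<bar>r\<bar> \<le> \<bar>s\<bar>" and t: "\<bar>t - r\<bar> * k \<le> 1/2" for r t
    unfolding P_def
  proof
    fix y assume y: "y \<in> Y"
    obtain u where u: "\<And>g. g \<in> Y \<Longrightarrow> u g \<in> D \<and> T (u g) + r *\<^sub>R V (u g) = g"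
      using r(1) unfolding P_def by metis
    \<comment> \<open>A fixed point \<open>g\<close> makes the solution at \<open>r\<close> with
      right hand side \<open>g\<close> a solution at \<open>t\<close> with right hand side
      \<open>y\<close>.\<close>
    define \<phi> where "\<phi> g = y - (t - r) *\<^sub>R V (u g)" for g
    have "\<exists>!g. g \<in> Y \<and> \<phi> g = g"
    proof (rule Banach_fix)
      show "complete Y" using Y complete_eq_closed by blast
      show "Y \<noteq> {}" using y by auto
      show "\<phi> ` Y \<subseteq> Y"
        using u V y Y by (auto simp: \<phi>_def intro!: subspace_diff subspace_scale)
      fix g h assume gh: "g \<in> Y" "h \<in> Y"
      have d: "u h - u g \<in> D" using u gh D by (simp add: subspace_diff)
      have "dist (\<phi> g) (\<phi> h) = norm ((t - r) *\<^sub>R V (u h - u g))"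
        using u gh by (simp add: \<phi>_def dist_norm V scaleR_right_diff_distrib)
      also have "\<dots> \<le> \<bar>t - r\<bar> * (k * norm (T (u h - u g) + r *\<^sub>R V (u h - u g)))"
        using bound[OF r(2) d] by (simp add: mult_left_mono)
      also have "T (u h - u g) + r *\<^sub>R V (u h - u g) = h - g"
        using u gh by (simp add: T V scaleR_right_diff_distrib) (metis add_diff_add)
      also have "\<bar>t - r\<bar> * (k * norm (h - g)) \<le> 1/2 * norm (h - g)"
        using mult_right_mono[OF t norm_ge_zero, of "h - g"] by (simp add: mult.assoc)
      finally show "dist (\<phi> g) (\<phi> h) \<le> 1/2 * dist g h" by (simp add: dist_norm norm_minus_commute)
    qed auto
    then obtain g where g: "g \<in> Y" "\<phi> g = g" by blast
    have "T (u g) + t *\<^sub>R V (u g) = (T (u g) + r *\<^sub>R V (u g)) + (t - r) *\<^sub>R V (u g)"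
      by (simp add: algebra_simps)
    also have "\<dots> = \<phi> g + (t - r) *\<^sub>R V (u g)" using u[OF g(1)] g(2) by simp
    also have "\<dots> = y" by (simp add: \<phi>_def)
    finally show "\<exists>u\<in>D. T u + t *\<^sub>R V u = y" using u[OF g(1)] by blast
  qed
  \<comment> \<open>Fine enough for steps of length \<open>\<bar>s\<bar> / Suc n\<close>; the
    absolute value covers a \<open>k\<close> of either sign.\<close>
  obtain n :: nat where n: "2 * (\<bar>s\<bar> * \<bar>k\<bar>) \<le> real n" using real_arch_simple by blast
  have "P (s * real j / real (Suc n))" if "j \<le> Suc n" for j
    using that
  proof (induction j)
    case 0
    then show ?case using surj by (auto simp: P_def)
  next
    case (Suc j)
    show ?case
    proof (rule step)
      show "P (s * real j / real (Suc n))" using Suc by simp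
      show "\<bar>s * real j / real (Suc n)\<bar> \<le> \<bar>s\<bar>"
        using Suc.prems by (simp add: abs_mult divide_le_eq mult_left_mono)
      have "\<bar>s * real (Suc j) / real (Suc n) - s * real j / real (Suc n)\<bar> = \<bar>s\<bar> / real (Suc n)"
        by (simp add: abs_divide diff_divide_distrib[symmetric] algebra_simps del: of_nat_Suc)
          (simp add: algebra_simps)
      moreover have "\<bar>s\<bar> * k \<le> \<bar>s\<bar> * \<bar>k\<bar>" by (simp add: mult_left_mono)
      ultimately show "\<bar>s * real (Suc j) / real (Suc n) - s * real j / real (Suc n)\<bar> * k \<le> 1 / 2"
        using n by (simp add: divide_le_eq)
    qed
  qed
  from this[of "Suc n"] have "P s" by simp
  then show ?thesis by (force simp: P_def)
qed

text \<open>Normalize a sequence of counterexamples in the graph norm of \<open>T\<close>.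
  Compactness bounds \<open>K \<cdot> v n\<close>, so along a subsequence \<open>v n\<close> tends
  to 0 and \<open>K \<cdot> v n\<close> converges, to 0 since the graph is closed. Then
  \<open>T \<cdot> v n\<close> tends to 0 as well, against the normalization.\<close>

lemma relatively_compact_imp_bounded:
  fixes K T :: "'a::chilbert_space operator"
  assumes K: "linear_op K" "closed_op K" and T: "linear_op T" and rc: "relatively_compact_op K T"
    and \<epsilon>: "\<epsilon> > 0"
  shows "\<exists>C\<ge>0. \<forall>u\<in>dom T. norm (K \<cdot> u) \<le> \<epsilon> * norm (T \<cdot> u) + C * norm u"
proof (rule ccontr)
  assume "\<not> ?thesis"
  then have "\<forall>n. \<exists>u. u \<in> dom T \<and> norm (K \<cdot> u) > \<epsilon> * norm (T \<cdot> u) + real n * norm u"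
    by (metis linorder_not_le of_nat_0_le_iff)
  then obtain u where u: "\<And>n. u n \<in> dom T"
    "\<And>n. norm (K \<cdot> u n) > \<epsilon> * norm (T \<cdot> u n) + real n * norm (u n)" by metis
  have TK: "dom T \<subseteq> dom K" using rc by (simp add: relatively_compact_op_def)
  define N where "N n = norm (u n) + norm (T \<cdot> u n)" for n
  define v where "v n = (1 / N n) *\<^sub>R u n" for n
  have N: "N n > 0" for n
  proof -
    have "u n \<noteq> 0" using u(2)[of n] by (auto simp: linear_op_zero[OF K(1)] linear_op_zero[OF T])
    then show ?thesis by (simp add: N_def add_pos_nonneg)
  qed
  have v_dom: "v n \<in> dom T" for n
    unfolding v_def by (rule csubspaceD(6)[OF linear_op_csubspace[OF T] u(1)])
  have v_sum: "norm (v n) + norm (T \<cdot> v n) = 1" for n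
    using N[of n] u(1) by (simp add: v_def linear_op_scaleR[OF T] N_def add_divide_distrib[symmetric])
  have v_gt: "norm (K \<cdot> v n) \<ge> \<epsilon> * norm (T \<cdot> v n) + real n * norm (v n)" for n
  proof -
    have "(\<epsilon> * norm (T \<cdot> u n) + real n * norm (u n)) / N n \<le> norm (K \<cdot> u n) / N n"
      using u(2)[of n] N[of n] by (intro divide_right_mono) auto
    moreover have "K \<cdot> v n = (1 / N n) *\<^sub>R (K \<cdot> u n)" "T \<cdot> v n = (1 / N n) *\<^sub>R (T \<cdot> u n)"
      unfolding v_def
      by (rule linear_op_scaleR[OF K(1) subsetD[OF TK u(1)]], rule linear_op_scaleR[OF T u(1)])
    ultimately show ?thesis using N[of n] by (simp add: v_def add_divide_distrib)
  qed
  have "\<exists>b. \<forall>x\<in>range v. norm x + norm (T \<cdot> x) \<le> b"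
    by (rule exI[of _ 1]) (auto simp: v_sum)
  moreover have "range v \<subseteq> dom T" using v_dom by blast
  ultimately have cpt: "compact (closure ((\<lambda>u. K \<cdot> u) ` range v))"
    using rc by (simp add: relatively_compact_op_def)
  have mem: "K \<cdot> v n \<in> closure ((\<lambda>u. K \<cdot> u) ` range v)" for n
    by (rule subsetD[OF closure_subset]) auto
  obtain l r where "l \<in> closure ((\<lambda>u. K \<cdot> u) ` range v)"
    and r: "strict_mono r" "((\<lambda>n. K \<cdot> v n) \<circ> r) \<longlonglongrightarrow> l"
    by (rule seq_compactE[OF compact_imp_seq_compact[OF cpt], of "\<lambda>n. K \<cdot> v n"]) (use mem in auto)
  have lim: "(\<lambda>n. K \<cdot> v (r n)) \<longlonglongrightarrow> l" using r(2) by (simp add: o_def)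
  obtain B where B: "\<And>n. norm (K \<cdot> v n) \<le> B"
    using compact_imp_bounded[OF cpt] mem by (auto simp: bounded_iff)
  have "(\<lambda>n. v (r n)) \<longlonglongrightarrow> 0"
  proof (rule Lim_null_comparison)
    have "norm (v (r n)) \<le> B / real n" if "n > 0" for n
    proof -
      have "real n * norm (v (r n)) \<le> real (r n) * norm (v (r n))"
        using seq_suble[OF r(1)] by (intro mult_right_mono) auto
      also have "\<dots> \<le> B" using v_gt[of "r n"] B[of "r n"] \<epsilon> 
        by (smt (verit) mult_nonneg_nonneg norm_ge_zero)
      finally show ?thesis using that by (simp add: field_simps)
    qed
    then show "\<forall>\<^sub>F n in sequentially. norm (v (r n)) \<le> B / real n"
      by (intro eventually_sequentiallyI[of 1]) auto
    show "(\<lambda>n. B / real n) \<longlonglongrightarrow> 0" by (rule lim_const_over_n)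
  qed
  note v0 = this
  have "(\<lambda>n. (v (r n), K \<cdot> v (r n))) \<longlonglongrightarrow> (0, l)" by (intro tendsto_Pair v0 lim)
  moreover have "(v (r n), K \<cdot> v (r n)) \<in> Map.graph K" for n
    using subsetD[OF TK v_dom[of "r n"]] by (auto simp: Map.graph_def)
  ultimately have "(0, l) \<in> Map.graph K"
    using closed_sequentially[OF K(2)[unfolded closed_op_def], of "\<lambda>n. (v (r n), K \<cdot> v (r n))"]
    by (simp add: o_def)
  then have "l = K \<cdot> 0" by (auto simp: Map.graph_def)
  then have "l = 0" using linear_op_zero[OF K(1)] by simp
  with lim have "(\<lambda>n. norm (K \<cdot> v (r n)) / \<epsilon>) \<longlonglongrightarrow> norm (0::'a) / \<epsilon>"
    by (intro tendsto_intros) (use \<epsilon> in auto)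
  moreover have "norm (T \<cdot> v (r n)) \<le> norm (K \<cdot> v (r n)) / \<epsilon>" for n
    using v_gt[of "r n"] \<epsilon> by (simp add: field_simps) (smt (verit) mult_nonneg_nonneg norm_ge_zero of_nat_0_le_iff)
  ultimately have "(\<lambda>n. T \<cdot> v (r n)) \<longlonglongrightarrow> 0"
    by (intro Lim_null_comparison[of "\<lambda>n. T \<cdot> v (r n)"]) auto
  from tendsto_add[OF tendsto_norm[OF v0] tendsto_norm[OF this]]
  have "(\<lambda>n. 1) \<longlonglongrightarrow> (0::real)" by (simp add: v_sum)
  then show False using LIMSEQ_unique tendsto_const zero_neq_one by metis
qed

section \<open>Real inequalities behind the resolvent estimate\<close>

text \<open>Absorbs the linear term by \<open>2 * p * x \<le> p\<^sup>2 + x\<^sup>2\<close>; applied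
  below once in \<open>d\<close> and once in \<open>n\<close>.\<close>

lemma le_linear_plus_imp_sq_le:
  fixes x p q :: real
  assumes "x\<^sup>2 \<le> p * x + q"
  shows "x\<^sup>2 \<le> p\<^sup>2 + 2 * q"
  using assms zero_le_power2[of "p - x"] by (simp add: power2_diff) 

text \<open>Here \<open>\<phi>\<close> is the norm of the right hand side \<open>f\<close>, and \<open>n\<close>, \<open>s\<close>, \<open>b\<close>, \<open>d\<close> are the norms of \<open>u\<close>,
  \<open>S u\<close>, \<open>B3 u\<close> and \<open>\<mu> u - \<Lambda> u\<close> for the solution \<open>u\<close> of the resolvent equation.\<close>

lemma resolvent_arithmetic:
  fixes n d s b \<phi> a :: real
  assumes pos: "0 < a" "0 \<le> n" "0 \<le> d" "0 \<le> s" "0 \<le> b" "0 \<le> \<phi>" "0 \<le> m1" "0 \<le> m2" "0 \<le> h1" "0 \<le> h2"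
      "0 < C" "0 < K"
    and d: "a * d\<^sup>2 \<le> \<phi> * d + C * s * b"
    and n: "n\<^sup>2 \<le> C * (m1\<^sup>2 * d\<^sup>2 + h1\<^sup>2 * s\<^sup>2)"
    and b: "b\<^sup>2 \<le> C * (m2\<^sup>2 * d\<^sup>2 + h2\<^sup>2 * s\<^sup>2)"
    and s: "s\<^sup>2 \<le> K * \<phi> * n"
    and D: "D = C * sqrt C" and M: "M = C * (2 * D\<^sup>2 + 2 * D + 1) * K + 2 * sqrt C"
  shows "n \<le> M * (m1 / a + m1\<^sup>2 * m2\<^sup>2 / a\<^sup>2 + m1\<^sup>2 * h2 / a + h1\<^sup>2) * \<phi>"
proof -
  define E where "E = m1\<^sup>2 * m2\<^sup>2 / a\<^sup>2 + m1\<^sup>2 * h2 / a + h1\<^sup>2"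
  have D0: "D \<ge> 0" using pos by (simp add: D)
  have E0: "E \<ge> 0" using pos by (simp add: E_def)
  \<comment> \<open>First \<open>b\<close> is eliminated, which produces \<open>D\<close>; then the
    quadratic inequality for \<open>d\<close> is resolved, \<open>s\<close> is replaced through its
    bound by \<open>n\<close>, and a quadratic inequality in \<open>n\<close> remains.\<close>
  have "b\<^sup>2 \<le> C * (m2 * d + h2 * s)\<^sup>2"
  proof -
    have "m2\<^sup>2 * d\<^sup>2 + h2\<^sup>2 * s\<^sup>2 \<le> (m2 * d + h2 * s)\<^sup>2"
      using pos by (simp add: power2_sum power_mult_distrib)
    with b pos show ?thesis by (meson mult_left_mono order_trans less_imp_le)
  qed
  also have "\<dots> = (sqrt C * (m2 * d + h2 * s))\<^sup>2" using pos by (simp add: power_mult_distrib)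
  finally have b': "b \<le> sqrt C * (m2 * d + h2 * s)"
    using pos by (auto intro: power2_le_imp_le)
  have "a * d\<^sup>2 \<le> \<phi> * d + C * s * (sqrt C * (m2 * d + h2 * s))"
  proof -
    have "C * s * b \<le> C * s * (sqrt C * (m2 * d + h2 * s))"
      by (rule mult_left_mono[OF b']) (use pos in simp)
    with d show ?thesis by linarith
  qed
  also have "\<dots> = (\<phi> + D * m2 * s) * d + D * h2 * s\<^sup>2"
    by (simp add: D algebra_simps power2_eq_square)
  finally have "d\<^sup>2 \<le> ((\<phi> + D * m2 * s) / a) * d + D * h2 * s\<^sup>2 / a"
    using pos(1) by (simp add: field_simps)
  from le_linear_plus_imp_sq_le[OF this]
  have "d\<^sup>2 \<le> (\<phi> + D * m2 * s)\<^sup>2 / a\<^sup>2 + 2 * (D * h2 * s\<^sup>2 / a)"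
    by (simp add: power_divide)
  also have "(\<phi> + D * m2 * s)\<^sup>2 \<le> 2 * \<phi>\<^sup>2 + 2 * (D * m2 * s)\<^sup>2"
    using zero_le_power2[of "\<phi> - D * m2 * s"] by (simp add: power2_sum power2_diff)
  finally have "d\<^sup>2 \<le> (2 * \<phi>\<^sup>2 + 2 * (D * m2 * s)\<^sup>2) / a\<^sup>2 + 2 * (D * h2 * s\<^sup>2 / a)"
    by (simp add: divide_right_mono)
  then have "m1\<^sup>2 * d\<^sup>2 \<le> m1\<^sup>2 * ((2 * \<phi>\<^sup>2 + 2 * (D * m2 * s)\<^sup>2) / a\<^sup>2 + 2 * (D * h2 * s\<^sup>2 / a))"
    by (rule mult_left_mono) simp
  also have "\<dots> = 2 * (m1 / a * \<phi>)\<^sup>2 + (2 * D\<^sup>2 * (m1\<^sup>2 * m2\<^sup>2 / a\<^sup>2) + 2 * D * (m1\<^sup>2 * h2 / a)) * s\<^sup>2"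
    using pos(1) by (simp add: field_simps power2_eq_square)
  finally have "m1\<^sup>2 * d\<^sup>2 + h1\<^sup>2 * s\<^sup>2 \<le> 2 * (m1 / a * \<phi>)\<^sup>2
      + (2 * D\<^sup>2 * (m1\<^sup>2 * m2\<^sup>2 / a\<^sup>2) + 2 * D * (m1\<^sup>2 * h2 / a) + h1\<^sup>2) * s\<^sup>2"
    by (simp add: algebra_simps)
  also have "\<dots> \<le> 2 * (m1 / a * \<phi>)\<^sup>2 + ((2 * D\<^sup>2 + 2 * D + 1) * E) * s\<^sup>2"
  proof -
    define x y where "x = m1\<^sup>2 * m2\<^sup>2 / a\<^sup>2" and "y = m1\<^sup>2 * h2 / a"
    have xy: "x \<ge> 0" "y \<ge> 0" using pos by (auto simp: x_def y_def)
    have "2 * D\<^sup>2 * x + 2 * D * y + h1\<^sup>2 \<le> (2 * D\<^sup>2 + 2 * D + 1) * (x + y + h1\<^sup>2)"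
      using xy D0 by (simp add: algebra_simps)
    then have "(2 * D\<^sup>2 * x + 2 * D * y + h1\<^sup>2) * s\<^sup>2 \<le> ((2 * D\<^sup>2 + 2 * D + 1) * (x + y + h1\<^sup>2)) * s\<^sup>2"
      by (rule mult_right_mono) simp
    then show ?thesis by (simp add: x_def y_def E_def)
  qed
  also have "\<dots> \<le> 2 * (m1 / a * \<phi>)\<^sup>2 + ((2 * D\<^sup>2 + 2 * D + 1) * E) * (K * \<phi> * n)"
    using s E0 D0 by (simp add: mult_left_mono)
  finally have "n\<^sup>2 \<le> C * (2 * (m1 / a * \<phi>)\<^sup>2 + ((2 * D\<^sup>2 + 2 * D + 1) * E) * (K * \<phi> * n))"
    using n pos by (meson mult_left_mono order_trans less_imp_le)
  \<comment> \<open>A term linear in \<open>n\<close> with factor \<open>E\<close>, plus a pure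
    square from \<open>m1 / a\<close>; after the square root their coefficients are the two summands
    of \<open>M\<close>.\<close>
  also have "\<dots> = (C * (2 * D\<^sup>2 + 2 * D + 1) * K * E * \<phi>) * n + 2 * C * (m1 / a * \<phi>)\<^sup>2"
    by (simp add: algebra_simps)
  finally have "n\<^sup>2 \<le> (C * (2 * D\<^sup>2 + 2 * D + 1) * K * E * \<phi>)\<^sup>2 + 2 * (2 * C * (m1 / a * \<phi>)\<^sup>2)"
    by (rule le_linear_plus_imp_sq_le)
  also have "\<dots> = (C * (2 * D\<^sup>2 + 2 * D + 1) * K * E * \<phi>)\<^sup>2 + (2 * sqrt C * (m1 / a * \<phi>))\<^sup>2"
    using pos by (simp only: power_mult_distrib) simp
  also have "\<dots> \<le> (C * (2 * D\<^sup>2 + 2 * D + 1) * K * E * \<phi> + 2 * sqrt C * (m1 / a * \<phi>))\<^sup>2"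
    using pos D0 E0 by (simp add: power2_sum)
  finally have "n \<le> C * (2 * D\<^sup>2 + 2 * D + 1) * K * E * \<phi> + 2 * sqrt C * (m1 / a * \<phi>)"
    using pos D0 E0 by (auto intro: power2_le_imp_le)
  also have "\<dots> \<le> M * (m1 / a + E) * \<phi>"
  proof -
    define p q e where "p = C * (2 * D\<^sup>2 + 2 * D + 1) * K" and "q = 2 * sqrt C" and "e = m1 / a"
    have "p \<ge> 0" "q \<ge> 0" "e \<ge> 0" using pos D0 by (auto simp: p_def q_def e_def)
    then have "0 \<le> p * e * \<phi> + q * E * \<phi>" using E0 pos by simp
    then have "p * E * \<phi> + q * (e * \<phi>) \<le> (p + q) * (e + E) * \<phi>"
      by (simp add: algebra_simps)
    then show ?thesis by (simp add: p_def q_def e_def M)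
  qed
  finally show ?thesis by (simp add: E_def add.assoc)
qed

section \<open>Negatives and kernels of operators\<close>

lemma dom_op_uminus [simp]: "dom (op_uminus T) = dom T"
  by (simp add: op_uminus_def)

lemma op_uminus_apply [simp]: "u \<in> dom T \<Longrightarrow> op_uminus T \<cdot> u = - (T \<cdot> u)"
  by (simp add: op_uminus_def)

lemma linear_op_uminus: "linear_op T \<Longrightarrow> linear_op (op_uminus T)"
  unfolding linear_op_def by simp

lemma self_adjoint_uminus:
  assumes T: "self_adjoint T"
  shows "self_adjoint (op_uminus T)"
proof -
  have d: "densely_defined (op_uminus T)" and l: "linear_op (op_uminus T)"
    using T by (auto simp: self_adjoint_def densely_defined_def intro: linear_op_uminus)
  have adj: "v \<in> dom (adjoint_op (op_uminus T)) \<and> adjoint_op (op_uminus T) \<cdot> v = op_uminus T \<cdot> v"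
    if v: "v \<in> dom T" for v
    using adjoint_op_eqI[OF d, of v "- (T \<cdot> v)"] v self_adjoint_symmetric[OF T _ v] by simp
  have "adjoint_op (op_uminus T) = op_uminus T"
  proof (rule op_eqI)
    show "dom (adjoint_op (op_uminus T)) = dom (op_uminus T)"
    proof
      show "dom (adjoint_op (op_uminus T)) \<subseteq> dom (op_uminus T)"
      proof
        fix v assume v: "v \<in> dom (adjoint_op (op_uminus T))"
        have "\<langle>T \<cdot> u, v\<rangle> = \<langle>u, - (adjoint_op (op_uminus T) \<cdot> v)\<rangle>" if "u \<in> dom T" for u
        proof -
          have "- \<langle>T \<cdot> u, v\<rangle> = \<langle>u, adjoint_op (op_uminus T) \<cdot> v\<rangle>"
            using adjoint_op_cinner[OF d v, of u] that by simp
          then show ?thesis by (metis cinner_minus_right minus_minus)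
        qed
        from self_adjoint_maximal(1)[OF T this] show "v \<in> dom (op_uminus T)" by simp
      qed
    qed (use adj in auto)
  qed (use adj in auto)
  with d l show ?thesis by (simp add: self_adjoint_def)
qed

lemma op_ker_closed:
  assumes "linear_op T" "closed_op T"
  shows "closed (op_ker T)"
proof -
  have "op_ker T = (\<lambda>u. (u, 0)) -` Map.graph T"
    by (auto simp: op_ker_def Map.graph_def)
  moreover have "continuous_on UNIV (\<lambda>u::'a. (u, 0::'a))" by (intro continuous_intros)
  ultimately show ?thesis
    using assms(2) unfolding closed_op_def by (metis closed_vimage)
qed

lemma op_ker_csubspace: "linear_op T \<Longrightarrow> csubspace (op_ker T)"
  using linear_op_csubspace[of T]
  by (auto simp: csubspace_def op_ker_def linear_op_add linear_op_scaleC linear_op_zero)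

section \<open>The operators \<open>A - \<i> \<alpha> \<Lambda>\<close>\<close>

text \<open>The hypotheses on \<open>A\<close>, \<open>\<Lambda>\<close>, \<open>B1\<close> and
  \<open>B2\<close>; the weights, \<open>B3\<close> and the threshold \<open>\<tau>\<close> enter in
  \<open>resolvent_estimate\<close>. Here \<open>c\<close> is the coercivity constant on
  \<open>Y\<close> and \<open>C\<close> the bound for \<open>B2\<close> on the whole space.\<close>

locale dissipative_pair =
  fixes A \<Lambda> B1 B2 S :: "'a::chilbert_space operator"
    and Y :: "'a set" and Q :: "'a \<Rightarrow> 'a" and c C :: real
  assumes Y_def: "Y = orth_compl (op_ker \<Lambda>)"
    and Q_def: "Q = orth_proj Y"
    and S_def: "S = op_sqrt (op_uminus A)"
    and A_self_adjoint: "self_adjoint A"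
    and A_coercive: "\<And>u. u \<in> dom A \<Longrightarrow> (norm u)\<^sup>2 \<le> Re \<langle>- (A \<cdot> u), u\<rangle>"
    and \<Lambda>_linear: "linear_op \<Lambda>" and \<Lambda>_dense: "densely_defined \<Lambda>" and \<Lambda>_closed: "closed_op \<Lambda>"
    and \<Lambda>_compact: "relatively_compact_op \<Lambda> (op_uminus A)"
    and Q_A: "\<And>u. u \<in> dom A \<Longrightarrow> Q u \<in> dom A \<and> A \<cdot> (Q u) = Q (A \<cdot> u)"
    and adjoint_dom: "dom A \<subseteq> dom (adjoint_op \<Lambda>)"
    and B1_symmetric: "symmetric_op B1" and B2_symmetric: "symmetric_op B2"
    and \<Lambda>_eq: "\<Lambda> = B1 \<circ>\<^sub>m B2" and ker_eq: "op_ker \<Lambda> = op_ker B2"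
    and c_pos: "c > 0" and C_pos: "C > 0"
    and B2_coercive: "\<And>u. u \<in> dom A \<inter> Y \<Longrightarrow> Re \<langle>u, B2 \<cdot> u\<rangle> \<ge> c * (norm u)\<^sup>2"
    and AB2_coercive: "\<And>u. u \<in> dom A \<inter> Y \<Longrightarrow> Re \<langle>- (A \<cdot> u), B2 \<cdot> u\<rangle> \<ge> c * (norm (S \<cdot> u))\<^sup>2"
    and ker_dom: "op_ker \<Lambda> \<subseteq> dom A"
    and B2_bounded: "\<And>u. u \<in> dom B2 \<and> norm (B2 \<cdot> u) \<le> C * norm u"
begin

section \<open>Splitting of the space into \<open>Y\<close> and the kernel \<open>N\<close>\<close>

abbreviation N :: "'a set" where "N \<equiv> op_ker \<Lambda>"

definition P :: "'a \<Rightarrow> 'a" where "P u = u - Q u"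

lemma A_linear: "linear_op A"
  using A_self_adjoint by (simp add: self_adjoint_def)

lemmas A_sub = csubspaceD[OF linear_op_csubspace[OF A_linear]]
lemmas N_sub = csubspaceD[OF op_ker_csubspace[OF \<Lambda>_linear]]
lemmas A_add = linear_op_add[OF A_linear]
lemmas A_diff = linear_op_diff[OF A_linear]

lemma Y_csubspace: "csubspace Y"
  unfolding Y_def by (rule csubspace_orth_compl)

lemma Y_closed: "closed Y"
  unfolding Y_def by (rule closed_orth_compl)

lemmas Y_sub = csubspaceD[OF Y_csubspace]

lemma Y_orth: "y \<in> Y \<Longrightarrow> n \<in> N \<Longrightarrow> \<langle>y, n\<rangle> = 0" "y \<in> Y \<Longrightarrow> n \<in> N \<Longrightarrow> \<langle>n, y\<rangle> = 0"
  using cinner_commute[of n y] by (auto simp: Y_def orth_compl_def)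

text \<open>Two candidates differ by a vector of \<open>Y\<close> orthogonal to itself. With the
  remainder tested by membership in \<open>N\<close>, linearity of \<open>Q\<close> follows from the
  subspace properties of \<open>Y\<close> and \<open>N\<close>.\<close>

lemma Q_eqI:
  assumes "y \<in> Y" "x - y \<in> N"
  shows "Q x = y"
  unfolding Q_def orth_proj_def
proof (rule the_equality)
  show "y \<in> Y \<and> x - y \<in> orth_compl Y"
    using assms Y_orth by (auto simp: orth_compl_def)
  fix z assume z: "z \<in> Y \<and> x - z \<in> orth_compl Y"
  have "y - z \<in> Y" using assms z Y_sub(3) by blast
  then have "\<langle>x - z, y - z\<rangle> = 0" "\<langle>x - y, y - z\<rangle> = 0"
    using z assms(2) Y_orth by (auto simp: orth_compl_def)
  moreover have "\<langle>y - z, y - z\<rangle> = \<langle>x - z, y - z\<rangle> - \<langle>x - y, y - z\<rangle>"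
    by (simp add: cinner_diff_left[symmetric])
  ultimately show "z = y" by (simp add: cinner_self)
qed

text \<open>The decomposition is taken along the closed subspace \<open>N\<close>, not along
  \<open>Y\<close>; so the remainders of \<open>Q\<close> lie in \<open>N\<close> itself and not
  merely in the complement of \<open>Y\<close>.\<close>

lemma Q_in_Y: "Q x \<in> Y" and P_in_N: "P x \<in> N"
proof -
  obtain n where n: "n \<in> N" "x - n \<in> Y"
    using orth_decomposition[OF op_ker_closed[OF \<Lambda>_linear \<Lambda>_closed] op_ker_csubspace[OF \<Lambda>_linear]]
    unfolding Y_def by blast
  then have "Q x = x - n" by (intro Q_eqI) auto
  with n show "Q x \<in> Y" "P x \<in> N" by (auto simp: P_def)
qed

lemma Q_plus_P: "Q x + P x = x"
  by (simp add: P_def)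

lemma Q_on_Y [simp]: "y \<in> Y \<Longrightarrow> Q y = y"
  by (rule Q_eqI) (simp_all add: N_sub)

lemma Q_on_N [simp]: "n \<in> N \<Longrightarrow> Q n = 0"
  by (rule Q_eqI) (simp_all add: Y_sub)

lemma Q_add: "Q (x + y) = Q x + Q y"
proof (rule Q_eqI)
  have "x + y - (Q x + Q y) = P x + P y" by (simp add: P_def)
  then show "x + y - (Q x + Q y) \<in> N" using N_sub(2)[OF P_in_N P_in_N] by simp
qed (intro Y_sub Q_in_Y)

lemma Q_scaleC: "Q (a *\<^sub>C x) = a *\<^sub>C Q x"
proof (rule Q_eqI)
  have "a *\<^sub>C x - a *\<^sub>C Q x = a *\<^sub>C P x" by (simp add: P_def scaleC_diff_right)
  then show "a *\<^sub>C x - a *\<^sub>C Q x \<in> N" using N_sub(5)[OF P_in_N] by simp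
qed (intro Y_sub Q_in_Y)

lemma Q_minus: "Q (- x) = - Q x"
  using Q_scaleC[of "-1" x] by simp

lemma Q_diff: "Q (x - y) = Q x - Q y"
  using Q_add[of x "-y"] by (simp add: Q_minus)

lemma Q_scaleR: "Q (r *\<^sub>R x) = r *\<^sub>R Q x"
  by (simp add: scaleR_eq_scaleC Q_scaleC)

lemma P_add: "P (x + y) = P x + P y"
  by (simp add: P_def Q_add)

lemma P_diff: "P (x - y) = P x - P y"
  by (simp add: P_def Q_diff)

lemma P_scaleC: "P (a *\<^sub>C x) = a *\<^sub>C P x"
  by (simp add: P_def Q_scaleC scaleC_diff_right)

lemma P_on_Y [simp]: "y \<in> Y \<Longrightarrow> P y = 0"
  by (simp add: P_def)

lemma P_on_N [simp]: "n \<in> N \<Longrightarrow> P n = n"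
  by (simp add: P_def)

lemma norm_Q_P: "(norm x)\<^sup>2 = (norm (Q x))\<^sup>2 + (norm (P x))\<^sup>2"
proof -
  have "inner (Q x) (P x) = 0"
    by (simp add: inner_eq_Re_cinner Y_orth Q_in_Y P_in_N)
  then have "(norm (Q x + P x))\<^sup>2 = (norm (Q x))\<^sup>2 + (norm (P x))\<^sup>2"
    by (simp add: power2_norm_eq_inner inner_simps inner_commute)
  then show ?thesis by (simp add: Q_plus_P)
qed

lemma norm_Q_le: "norm (Q x) \<le> norm x"
proof (rule power2_le_imp_le)
  show "(norm (Q x))\<^sup>2 \<le> (norm x)\<^sup>2"
    using norm_Q_P[of x] zero_le_power2[of "norm (P x)"] by linarith
qed simp

lemma norm_P_le: "norm (P x) \<le> norm x"
proof (rule power2_le_imp_le)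
  show "(norm (P x))\<^sup>2 \<le> (norm x)\<^sup>2"
    using norm_Q_P[of x] zero_le_power2[of "norm (Q x)"] by linarith
qed simp

lemma cinner_Q_left:
  assumes "y \<in> Y"
  shows "\<langle>Q x, y\<rangle> = \<langle>x, y\<rangle>"
  using cinner_add_left[of "Q x" "P x" y] Y_orth(2)[OF assms P_in_N] by (simp add: Q_plus_P)

lemma cinner_Q_right:
  assumes "y \<in> Y"
  shows "\<langle>y, Q x\<rangle> = \<langle>y, x\<rangle>"
  using cinner_add_right[of y "Q x" "P x"] Y_orth(1)[OF assms P_in_N] by (simp add: Q_plus_P)

lemma cinner_P: "\<langle>x, P y\<rangle> = \<langle>P x, y\<rangle>"
proof -
  have "\<langle>x, P y\<rangle> = \<langle>P x, P y\<rangle>"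
    using cinner_add_left[of "Q x" "P x" "P y"] Y_orth(1)[OF Q_in_Y P_in_N]
    by (simp add: Q_plus_P)
  also have "\<dots> = \<langle>P x, y\<rangle>"
    using cinner_add_right[of "P x" "Q y" "P y"] Y_orth(2)[OF Q_in_Y P_in_N]
    by (simp add: Q_plus_P)
  finally show ?thesis .
qed

section \<open>Reduction of \<open>A\<close>, and properties of \<open>\<Lambda>\<close>,
  \<open>B2\<close> and the square root\<close>

lemma A_in_Y: "u \<in> dom A \<Longrightarrow> u \<in> Y \<Longrightarrow> A \<cdot> u \<in> Y"
  using Q_A[of u] Q_in_Y[of "A \<cdot> u"] by simp

lemma P_A: "u \<in> dom A \<Longrightarrow> P u \<in> dom A" "u \<in> dom A \<Longrightarrow> A \<cdot> P u = P (A \<cdot> u)"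
  using Q_A[of u] A_sub(3)[of u "Q u"] by (auto simp: P_def A_diff)

text \<open>Commutation with \<open>Q\<close> passes to \<open>P\<close>, and \<open>N\<close> lies
  in the domain; so \<open>A\<close> acts on \<open>N\<close> as an everywhere defined
  operator.\<close>

lemma A_in_N:
  assumes "u \<in> N"
  shows "A \<cdot> u \<in> N"
proof -
  have "A \<cdot> u = P (A \<cdot> u)" using P_A(2)[of u] ker_dom assms by auto
  then show ?thesis by (metis P_in_N)
qed

lemma A_dom_\<Lambda>: "u \<in> dom A \<Longrightarrow> u \<in> dom \<Lambda>"
  using \<Lambda>_compact by (auto simp: relatively_compact_op_def)

lemma \<Lambda>_on_N [simp]: "u \<in> N \<Longrightarrow> \<Lambda> \<cdot> u = 0"
  by (simp add: op_ker_def)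

lemma \<Lambda>_Q: "u \<in> dom A \<Longrightarrow> \<Lambda> \<cdot> Q u = \<Lambda> \<cdot> u"
  using linear_op_diff[OF \<Lambda>_linear A_dom_\<Lambda> A_dom_\<Lambda>, of u "Q u"] Q_A[of u] \<Lambda>_on_N[OF P_in_N, of u]
  by (simp add: P_def)

lemmas \<Lambda>_add = linear_op_add[OF \<Lambda>_linear A_dom_\<Lambda> A_dom_\<Lambda>]
lemmas \<Lambda>_diff = linear_op_diff[OF \<Lambda>_linear A_dom_\<Lambda> A_dom_\<Lambda>]

lemma B2_cinner: "\<langle>B2 \<cdot> u, v\<rangle> = \<langle>u, B2 \<cdot> v\<rangle>"
  using B2_symmetric B2_bounded by (auto simp: symmetric_op_def)

text \<open>Symmetry makes the range of \<open>B2\<close> orthogonal to its kernel, which equals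
  \<open>N\<close>. Consequently \<open>Q\<close> may be dropped in pairings with
  \<open>B2 \<cdot> u\<close>.\<close>

lemma B2_in_Y: "B2 \<cdot> u \<in> Y"
  using B2_cinner by (auto simp: Y_def orth_compl_def ker_eq) (simp add: op_ker_def)

lemma \<Lambda>_B2_real:
  assumes "u \<in> dom A"
  shows "Im \<langle>\<Lambda> \<cdot> u, B2 \<cdot> u\<rangle> = 0"
proof -
  obtain y where y: "B2 u = Some y" using B2_bounded[of u] by (auto simp: dom_def)
  have "u \<in> dom \<Lambda>" by (rule A_dom_\<Lambda>[OF assms])
  then have d: "y \<in> dom B1" "\<Lambda> \<cdot> u = B1 \<cdot> y" using y by (auto simp: \<Lambda>_eq map_comp_def)
  have "\<langle>B1 \<cdot> y, y\<rangle> = \<langle>y, B1 \<cdot> y\<rangle>" using B1_symmetric d by (auto simp: symmetric_op_def)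
  then have "\<langle>B1 \<cdot> y, y\<rangle> = cnj \<langle>B1 \<cdot> y, y\<rangle>" using cinner_commute[of "B1 \<cdot> y" y] by simp
  then show ?thesis using d y by (simp add: complex_eq_iff)
qed

lemma S_norm: "u \<in> dom A \<Longrightarrow> (norm (S \<cdot> u))\<^sup>2 = Re \<langle>- (A \<cdot> u), u\<rangle>"
  using norm_op_sqrt(2)[OF self_adjoint_uminus[OF A_self_adjoint], of u] A_coercive
  by (simp add: S_def)

lemma norm_le_S:
  assumes "u \<in> dom A"
  shows "norm u \<le> norm (S \<cdot> u)"
  using A_coercive[OF assms] unfolding S_norm[OF assms, symmetric]
  by (rule power2_le_imp_le[OF _ norm_ge_zero])

section \<open>Shifted operators and solvability on \<open>Y\<close>\<close>

text \<open>\<open>shiftX \<zeta> \<alpha>\<close> is \<open>\<zeta> - L\<^sub>\<alpha>\<close>, and on \<open>Y\<close>, where \<open>Q A = A\<close>, \<open>shiftY \<zeta> \<alpha>\<close> is \<open>\<zeta> - Q L\<^sub>\<alpha>\<close>.\<close>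

definition shiftA :: "complex \<Rightarrow> 'a \<Rightarrow> 'a" where
  "shiftA \<zeta> u = \<zeta> *\<^sub>C u - A \<cdot> u"

definition shiftY :: "complex \<Rightarrow> real \<Rightarrow> 'a \<Rightarrow> 'a" where
  "shiftY \<zeta> \<alpha> u = \<zeta> *\<^sub>C u - A \<cdot> u + (\<i> * complex_of_real \<alpha>) *\<^sub>C Q (\<Lambda> \<cdot> u)"

definition shiftX :: "complex \<Rightarrow> real \<Rightarrow> 'a \<Rightarrow> 'a" where
  "shiftX \<zeta> \<alpha> u = \<zeta> *\<^sub>C u - A \<cdot> u + (\<i> * complex_of_real \<alpha>) *\<^sub>C (\<Lambda> \<cdot> u)"

lemma shiftA_surj: "Re \<zeta> \<ge> 0 \<Longrightarrow> \<exists>u\<in>dom A. shiftA \<zeta> u = f"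
  using self_adjoint_shift_surj[OF self_adjoint_uminus[OF A_self_adjoint], of \<zeta> f] A_coercive
  by (auto simp: shiftA_def)

lemma shiftA_bound: "u \<in> dom A \<Longrightarrow> Re \<zeta> \<ge> 0 \<Longrightarrow> norm u \<le> norm (shiftA \<zeta> u)"
  using shift_lower_bound[OF A_coercive, of u \<zeta>] by (simp add: shiftA_def)

lemma shiftA_diff: "u \<in> dom A \<Longrightarrow> v \<in> dom A \<Longrightarrow> shiftA \<zeta> (u - v) = shiftA \<zeta> u - shiftA \<zeta> v"
  by (simp add: shiftA_def A_diff scaleC_diff_right)

lemma shiftA_add: "u \<in> dom A \<Longrightarrow> v \<in> dom A \<Longrightarrow> shiftA \<zeta> (u + v) = shiftA \<zeta> u + shiftA \<zeta> v"
  by (simp add: shiftA_def A_add scaleC_add_right)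

lemma Q_shiftA: "u \<in> dom A \<Longrightarrow> Q (shiftA \<zeta> u) = shiftA \<zeta> (Q u)"
  by (simp add: shiftA_def Q_diff Q_scaleC Q_A)

lemma P_shiftA: "u \<in> dom A \<Longrightarrow> P (shiftA \<zeta> u) = shiftA \<zeta> (P u)"
  by (simp add: shiftA_def P_diff P_scaleC P_A)

lemma shiftY_shiftA: "shiftY \<zeta> \<alpha> u = shiftA \<zeta> u + (\<i> * complex_of_real \<alpha>) *\<^sub>C Q (\<Lambda> \<cdot> u)"
  by (simp add: shiftY_def shiftA_def)

lemma shiftX_shiftA: "shiftX \<zeta> \<alpha> u = shiftA \<zeta> u + (\<i> * complex_of_real \<alpha>) *\<^sub>C (\<Lambda> \<cdot> u)"
  by (simp add: shiftX_def shiftA_def)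

lemma shiftA_in_Y: "u \<in> dom A \<inter> Y \<Longrightarrow> shiftA \<zeta> u \<in> Y"
  unfolding shiftA_def by (intro Y_sub(3) Y_sub(5) A_in_Y) auto

lemma shiftY_in_Y: "u \<in> dom A \<inter> Y \<Longrightarrow> shiftY \<zeta> \<alpha> u \<in> Y"
  unfolding shiftY_shiftA by (intro Y_sub(2) Y_sub(5) Q_in_Y shiftA_in_Y)

lemma shiftY_diff:
  "u \<in> dom A \<Longrightarrow> v \<in> dom A \<Longrightarrow> shiftY \<zeta> \<alpha> (u - v) = shiftY \<zeta> \<alpha> u - shiftY \<zeta> \<alpha> v"
  by (simp add: shiftY_shiftA shiftA_diff \<Lambda>_diff Q_diff scaleC_diff_right)

lemma shiftX_diff:
  "u \<in> dom A \<Longrightarrow> v \<in> dom A \<Longrightarrow> shiftX \<zeta> \<alpha> (u - v) = shiftX \<zeta> \<alpha> u - shiftX \<zeta> \<alpha> v"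
  by (simp add: shiftX_shiftA shiftA_diff \<Lambda>_diff scaleC_diff_right)

text \<open>\<open>\<Lambda>\<close> only sees \<open>Q u\<close>, so the component in
  \<open>Y\<close> satisfies an equation of its own, while in \<open>P_shiftX\<close> it appears as
  a source term: the triangular form.\<close>

lemma Q_shiftX: "u \<in> dom A \<Longrightarrow> Q (shiftX \<zeta> \<alpha> u) = shiftY \<zeta> \<alpha> (Q u)"
  by (simp add: shiftX_shiftA shiftY_shiftA Q_add Q_scaleC Q_shiftA \<Lambda>_Q)

lemma P_shiftX: "u \<in> dom A \<Longrightarrow> P (shiftX \<zeta> \<alpha> u)
    = shiftA \<zeta> (P u) + (\<i> * complex_of_real \<alpha>) *\<^sub>C P (\<Lambda> \<cdot> Q u)"
  by (simp add: shiftX_shiftA P_add P_scaleC P_shiftA \<Lambda>_Q)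

text \<open>Testing the equation against \<open>B2 u\<close> makes the contribution of the skew part purely
  imaginary, because \<open>\<langle>\<Lambda> u, B2 u\<rangle> = \<langle>B1 B2 u, B2 u\<rangle>\<close> is real.\<close>

lemma shiftY_energy:
  assumes u: "u \<in> dom A \<inter> Y" and \<zeta>: "Re \<zeta> \<ge> 0"
  shows "(norm (S \<cdot> u))\<^sup>2 \<le> C / c * norm (shiftY \<zeta> \<alpha> u) * norm u"
proof -
  have real: "Im \<langle>u, B2 \<cdot> u\<rangle> = 0"
    using arg_cong[OF B2_cinner[of u u], of Im] arg_cong[OF cinner_commute[of u "B2 \<cdot> u"], of Im]
    by simp
  have "0 \<le> Re \<langle>u, B2 \<cdot> u\<rangle>"
    using B2_coercive[OF u] c_pos by (meson mult_nonneg_nonneg less_imp_le zero_le_power2 order_trans)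
  then have 1: "0 \<le> Re (\<zeta> * \<langle>u, B2 \<cdot> u\<rangle>)" using \<zeta> real by simp
  have 2: "Re (\<i> * complex_of_real \<alpha> * \<langle>\<Lambda> \<cdot> u, B2 \<cdot> u\<rangle>) = 0"
    using \<Lambda>_B2_real[of u] u by simp
  have "\<langle>shiftY \<zeta> \<alpha> u, B2 \<cdot> u\<rangle> = \<zeta> * \<langle>u, B2 \<cdot> u\<rangle> + \<langle>- (A \<cdot> u), B2 \<cdot> u\<rangle>
      + \<i> * complex_of_real \<alpha> * \<langle>\<Lambda> \<cdot> u, B2 \<cdot> u\<rangle>"
    unfolding shiftY_def diff_conv_add_uminus cinner_add_left cinner_scaleC_left
      cinner_Q_left[OF B2_in_Y] ..
  then have "Re \<langle>- (A \<cdot> u), B2 \<cdot> u\<rangle> \<le> Re \<langle>shiftY \<zeta> \<alpha> u, B2 \<cdot> u\<rangle>"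
    using 1 2 by (simp only: plus_complex.sel)
  also have "\<dots> \<le> norm (shiftY \<zeta> \<alpha> u) * norm (B2 \<cdot> u)"
    by (rule order_trans[OF complex_Re_le_cmod cmod_cinner_le])
  also have "\<dots> \<le> norm (shiftY \<zeta> \<alpha> u) * (C * norm u)"
    using B2_bounded by (intro mult_left_mono) auto
  finally have "c * (norm (S \<cdot> u))\<^sup>2 \<le> norm (shiftY \<zeta> \<alpha> u) * (C * norm u)"
    using AB2_coercive[OF u] by linarith
  then show ?thesis using c_pos by (simp add: field_simps)
qed

text \<open>Energy inequality and \<open>norm_le_S\<close>, divided by \<open>norm u\<close>. The
  constant depends neither on \<open>\<alpha>\<close> nor on \<open>\<zeta>\<close>, as suits the
  continuity method.\<close>

lemma shiftY_bound:
  assumes u: "u \<in> dom A \<inter> Y" and \<zeta>: "Re \<zeta> \<ge> 0"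
  shows "norm u \<le> C / c * norm (shiftY \<zeta> \<alpha> u)"
proof -
  have "(norm u)\<^sup>2 \<le> (norm (S \<cdot> u))\<^sup>2" using norm_le_S u by (intro power_mono) auto
  with shiftY_energy[OF u \<zeta>, of \<alpha>]
  have le: "norm u * norm u \<le> (C / c * norm (shiftY \<zeta> \<alpha> u)) * norm u"
    by (simp add: power2_eq_square)
  show ?thesis
  proof (cases "u = 0")
    case False
    then show ?thesis using mult_right_le_imp_le[OF le] by simp
  qed (use c_pos C_pos in simp)
qed

text \<open>Continuity method in \<open>\<alpha>\<close>, starting from \<open>shiftA\<close>, which
  maps onto \<open>Y\<close> because it commutes with \<open>Q\<close>. The uniform bound on
  \<open>Q (\<Lambda> \<cdot> u)\<close> comes from absorbing \<open>A \<cdot> u\<close>, by the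
  small relative bound of \<open>\<Lambda>\<close>.\<close>

lemma shiftY_surj:
  assumes \<zeta>: "Re \<zeta> \<ge> 0"
  shows "Y \<subseteq> shiftY \<zeta> \<alpha> ` (dom A \<inter> Y)"
proof -
  let ?V = "\<lambda>u. \<i> *\<^sub>C Q (\<Lambda> \<cdot> u)"
  have eq: "shiftA \<zeta> u + t *\<^sub>R ?V u = shiftY \<zeta> t u" for t u
    by (simp add: shiftY_shiftA scaleR_eq_scaleC scaleC_scaleC mult.commute)
  \<comment> \<open>Makes \<open>\<bar>\<alpha>\<bar> * e \<le> 1/2\<close>, so that the term with
    \<open>A \<cdot> u\<close> on the right can be absorbed; the added 1 covers
    \<open>\<alpha> = 0\<close>.\<close>
  define e where "e = 1 / (2 * (\<bar>\<alpha>\<bar> + 1))"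
  have e: "e > 0" by (simp add: e_def add_nonneg_pos)
  obtain k where k: "k \<ge> 0" "\<And>u. u \<in> dom A \<Longrightarrow> norm (\<Lambda> \<cdot> u) \<le> e * norm (A \<cdot> u) + k * norm u"
    using relatively_compact_imp_bounded[OF \<Lambda>_linear \<Lambda>_closed linear_op_uminus[OF A_linear] \<Lambda>_compact e]
    by auto
  define K where "K = 2 * e * (1 + (cmod \<zeta> + \<bar>\<alpha>\<bar> * k) * (C / c)) + k * (C / c)"
  have "Y \<subseteq> (\<lambda>u. shiftA \<zeta> u + \<alpha> *\<^sub>R ?V u) ` (dom A \<inter> Y)"
  proof (rule continuity_method[where k = K])
    show "subspace (dom A \<inter> Y)"
      by (intro csubspace_imp_subspace csubspace_Int linear_op_csubspace A_linear Y_csubspace)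
    show "Y \<subseteq> shiftA \<zeta> ` (dom A \<inter> Y)"
    proof
      fix f assume f: "f \<in> Y"
      obtain u where u: "u \<in> dom A" "shiftA \<zeta> u = f" using shiftA_surj[OF \<zeta>] by blast
      then have "shiftA \<zeta> (Q u) = f" using Q_shiftA[of u \<zeta>] f by simp
      then show "f \<in> shiftA \<zeta> ` (dom A \<inter> Y)" using u Q_A Q_in_Y by blast
    qed
    fix t :: real and u assume t: "\<bar>t\<bar> \<le> \<bar>\<alpha>\<bar>" and u: "u \<in> dom A \<inter> Y"
    define w where "w = shiftY \<zeta> t u"
    have QL: "norm (Q (\<Lambda> \<cdot> u)) \<le> norm (\<Lambda> \<cdot> u)" by (rule norm_Q_le)
    have "A \<cdot> u = \<zeta> *\<^sub>C u + (\<i> * complex_of_real t) *\<^sub>C Q (\<Lambda> \<cdot> u) - w"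
      by (simp add: w_def shiftY_def)
    then have "norm (A \<cdot> u) \<le> norm (\<zeta> *\<^sub>C u) + norm ((\<i> * complex_of_real t) *\<^sub>C Q (\<Lambda> \<cdot> u)) + norm w"
      by (simp only:) (rule order_trans[OF norm_triangle_ineq4 add_right_mono[OF norm_triangle_ineq]])
    also have "\<dots> \<le> cmod \<zeta> * norm u + \<bar>\<alpha>\<bar> * norm (\<Lambda> \<cdot> u) + norm w"
      using mult_mono[OF t QL] by (simp add: norm_mult)
    also have "\<dots> \<le> cmod \<zeta> * norm u + \<bar>\<alpha>\<bar> * (e * norm (A \<cdot> u) + k * norm u) + norm w"
      using k(2)[of u] u by (simp add: mult_left_mono)
    finally have "norm (A \<cdot> u) \<le> (\<bar>\<alpha>\<bar> * e) * norm (A \<cdot> u) + (cmod \<zeta> + \<bar>\<alpha>\<bar> * k) * norm u + norm w"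
      by (simp add: algebra_simps)
    moreover have "(\<bar>\<alpha>\<bar> * e) * norm (A \<cdot> u) \<le> (1/2) * norm (A \<cdot> u)"
      by (intro mult_right_mono) (auto simp: e_def divide_le_eq)
    moreover have "x \<le> 2 * (p + q)" if "x \<le> y + p + q" "y \<le> 1/2 * x" for x y p q :: real
    proof -
      have "2 * x \<le> 2 * y + 2 * p + 2 * q" using that(1) by simp
      moreover have "2 * y \<le> x" using that(2) by simp
      ultimately show ?thesis by simp
    qed
    ultimately have Au: "norm (A \<cdot> u) \<le> 2 * ((cmod \<zeta> + \<bar>\<alpha>\<bar> * k) * norm u + norm w)" by blast
    have un: "norm u \<le> C / c * norm w" unfolding w_def by (rule shiftY_bound[OF u \<zeta>])
    have "norm (\<Lambda> \<cdot> u) \<le> e * norm (A \<cdot> u) + k * norm u" using k(2) u by simp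
    also have "\<dots> \<le> e * (2 * ((cmod \<zeta> + \<bar>\<alpha>\<bar> * k) * norm u + norm w)) + k * norm u"
      by (intro add_right_mono mult_left_mono[OF Au]) (use e in simp)
    also have "\<dots> \<le> e * (2 * ((cmod \<zeta> + \<bar>\<alpha>\<bar> * k) * (C / c * norm w) + norm w)) + k * (C / c * norm w)"
      by (intro add_mono mult_left_mono un) (use e k in auto)
    also have "\<dots> = K * norm w" by (simp add: K_def algebra_simps)
    finally show "norm (?V u) \<le> K * norm (shiftA \<zeta> u + t *\<^sub>R ?V u)"
      using QL by (simp add: eq w_def[symmetric])
  qed (auto simp: Y_closed csubspace_imp_subspace[OF Y_csubspace] shiftA_in_Y shiftA_diff
      Q_in_Y Y_sub \<Lambda>_diff Q_diff scaleC_diff_right)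
  then show ?thesis by (simp only: eq)
qed

lemma shiftY_inj: "Re \<zeta> \<ge> 0 \<Longrightarrow> inj_on (shiftY \<zeta> \<alpha>) (dom A \<inter> Y)"
proof (rule inj_onI)
  fix u v assume \<zeta>: "Re \<zeta> \<ge> 0" and uv: "u \<in> dom A \<inter> Y" "v \<in> dom A \<inter> Y" "shiftY \<zeta> \<alpha> u = shiftY \<zeta> \<alpha> v"
  then have "norm (u - v) \<le> C / c * norm (shiftY \<zeta> \<alpha> (u - v))"
    using A_sub(3)[of u v] Y_sub(3)[of u v] by (intro shiftY_bound) auto
  then show "u = v" using uv by (simp add: shiftY_diff)
qed

section \<open>Kernel components and inversion on the whole space\<close>

text \<open>\<open>P \<Lambda>\<close> and \<open>A P\<close> have the everywhere defined adjoints \<open>\<Lambda>\<^sup>* P\<close> and \<open>A P\<close>; boundedness follows from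
  the uniform boundedness principle.\<close>

lemma PL_bounded: "\<exists>K\<ge>0. \<forall>u\<in>dom A. norm (P (\<Lambda> \<cdot> u)) \<le> K * norm u"
proof -
  let ?W = "(\<lambda>u. (1 / norm u) *\<^sub>R P (\<Lambda> \<cdot> u)) ` (dom A - {0})"
  have "\<exists>K\<ge>0. \<forall>w\<in>?W. norm w \<le> K"
  proof (rule weakly_bounded_imp_bounded)
    fix x
    \<comment> \<open>The inclusions of \<open>N\<close> in \<open>dom A\<close> and of
      \<open>dom A\<close> in the domain of the adjoint make \<open>P x\<close> an admissible test
      vector for every \<open>x\<close>.\<close>
    have d: "P x \<in> dom (adjoint_op \<Lambda>)" using P_in_N ker_dom adjoint_dom by blast
    have "cmod \<langle>x, (1 / norm u) *\<^sub>R P (\<Lambda> \<cdot> u)\<rangle> \<le> norm (adjoint_op \<Lambda> \<cdot> P x)"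
      if u: "u \<in> dom A - {0}" for u
    proof -
      have "cmod \<langle>x, P (\<Lambda> \<cdot> u)\<rangle> = cmod \<langle>\<Lambda> \<cdot> u, P x\<rangle>"
        using cinner_commute[of "P x" "\<Lambda> \<cdot> u"] by (simp add: cinner_P)
      also have "\<dots> = cmod \<langle>u, adjoint_op \<Lambda> \<cdot> P x\<rangle>"
        using adjoint_op_cinner[OF \<Lambda>_dense d A_dom_\<Lambda>] u by simp
      also have "\<dots> \<le> norm u * norm (adjoint_op \<Lambda> \<cdot> P x)" by (rule cmod_cinner_le)
      finally show ?thesis
        using u by (simp add: scaleR_eq_scaleC cinner_scaleC_right norm_mult norm_divide field_simps)
    qed
    then show "\<exists>b. \<forall>w\<in>?W. cmod \<langle>x, w\<rangle> \<le> b" by blast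
  qed
  then obtain K where K: "K \<ge> 0" "\<And>u. u \<in> dom A - {0} \<Longrightarrow> norm ((1 / norm u) *\<^sub>R P (\<Lambda> \<cdot> u)) \<le> K"
    by blast
  have "norm (P (\<Lambda> \<cdot> u)) \<le> K * norm u" if "u \<in> dom A" for u
  proof (cases "u = 0")
    case True
    then show ?thesis using linear_op_zero[OF \<Lambda>_linear] P_on_N[OF N_sub(1)] by simp
  next
    case False
    then show ?thesis using K(2)[of u] that by (simp add: field_simps)
  qed
  with K show ?thesis by blast
qed

lemma A_bounded_on_N: "\<exists>K\<ge>0. \<forall>u\<in>N. norm (A \<cdot> u) \<le> K * norm u"
proof -
  let ?W = "(\<lambda>u. (1 / norm u) *\<^sub>R (A \<cdot> u)) ` (N - {0})"
  have "\<exists>K\<ge>0. \<forall>w\<in>?W. norm w \<le> K"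
  proof (rule weakly_bounded_imp_bounded)
    fix x
    have d: "P x \<in> dom A" using P_in_N ker_dom by blast
    have "cmod \<langle>x, (1 / norm u) *\<^sub>R (A \<cdot> u)\<rangle> \<le> norm (A \<cdot> P x)" if u: "u \<in> N - {0}" for u
    proof -
      have "\<langle>x, A \<cdot> u\<rangle> = \<langle>P x, A \<cdot> u\<rangle>" using A_in_N[of u] u by (simp add: cinner_P[symmetric])
      also have "\<dots> = \<langle>A \<cdot> P x, u\<rangle>"
        using self_adjoint_symmetric[OF A_self_adjoint d, of u] u ker_dom by (metis DiffD1 subsetD)
      finally have "cmod \<langle>x, A \<cdot> u\<rangle> \<le> norm (A \<cdot> P x) * norm u" by (simp add: cmod_cinner_le)
      then show ?thesis
        using u by (simp add: scaleR_eq_scaleC cinner_scaleC_right norm_mult norm_divide field_simps)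
    qed
    then show "\<exists>b. \<forall>w\<in>?W. cmod \<langle>x, w\<rangle> \<le> b" by blast
  qed
  then obtain K where K: "K \<ge> 0" "\<And>u. u \<in> N - {0} \<Longrightarrow> norm ((1 / norm u) *\<^sub>R (A \<cdot> u)) \<le> K"
    by blast
  have "norm (A \<cdot> u) \<le> K * norm u" if "u \<in> N" for u
  proof (cases "u = 0")
    case True
    then show ?thesis using linear_op_zero[OF A_linear] by simp
  next
    case False
    then show ?thesis using K(2)[of u] that by (simp add: field_simps)
  qed
  with K show ?thesis by blast
qed

text \<open>Substitution in the triangular system: \<open>Q u\<close> from
  \<open>shiftY_bound\<close>, then \<open>P u\<close> from \<open>shiftA_bound\<close> with the
  source term controlled by \<open>PL_bounded\<close>.\<close>

lemma shiftX_bound: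
  assumes \<zeta>: "Re \<zeta> \<ge> 0"
  shows "\<exists>K. \<forall>u\<in>dom A. norm u \<le> K * norm (shiftX \<zeta> \<alpha> u)"
proof -
  obtain k where k: "k \<ge> 0" "\<And>u. u \<in> dom A \<Longrightarrow> norm (P (\<Lambda> \<cdot> u)) \<le> k * norm u"
    using PL_bounded by blast
  have "norm u \<le> (C / c + (1 + \<bar>\<alpha>\<bar> * (k * (C / c)))) * norm (shiftX \<zeta> \<alpha> u)" if u: "u \<in> dom A" for u
  proof -
    define f where "f = shiftX \<zeta> \<alpha> u"
    have Qu: "Q u \<in> dom A \<inter> Y" using Q_A[OF u] Q_in_Y by blast
    have "norm (Q u) \<le> C / c * norm (Q f)"
      using shiftY_bound[OF Qu \<zeta>, of \<alpha>] Q_shiftX[OF u] by (simp add: f_def)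
    also have "\<dots> \<le> C / c * norm f" using c_pos C_pos norm_Q_le by (intro mult_left_mono) auto
    finally have 1: "norm (Q u) \<le> C / c * norm f" .
    have "norm (P u) \<le> norm (shiftA \<zeta> (P u))" by (rule shiftA_bound[OF P_A(1)[OF u] \<zeta>])
    also have "shiftA \<zeta> (P u) = P f - (\<i> * complex_of_real \<alpha>) *\<^sub>C P (\<Lambda> \<cdot> Q u)"
      using P_shiftX[OF u, of \<zeta> \<alpha>] by (simp add: f_def)
    also have "norm \<dots> \<le> norm (P f) + \<bar>\<alpha>\<bar> * norm (P (\<Lambda> \<cdot> Q u))"
      by (rule order_trans[OF norm_triangle_ineq4]) (simp add: norm_mult)
    also have "\<dots> \<le> norm f + \<bar>\<alpha>\<bar> * (k * (C / c * norm f))"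
    proof (intro add_mono norm_P_le mult_left_mono)
      show "norm (P (\<Lambda> \<cdot> Q u)) \<le> k * (C / c * norm f)"
        using k(2)[of "Q u"] Qu mult_left_mono[OF 1 k(1)] by simp
    qed simp
    finally have 2: "norm (P u) \<le> norm f + \<bar>\<alpha>\<bar> * (k * (C / c * norm f))" .
    have "norm u \<le> norm (Q u) + norm (P u)" using norm_triangle_ineq[of "Q u" "P u"] by (simp add: Q_plus_P)
    then have "norm u \<le> C / c * norm f + (norm f + \<bar>\<alpha>\<bar> * (k * (C / c * norm f)))" using 1 2 by linarith
    also have "\<dots> = (C / c + (1 + \<bar>\<alpha>\<bar> * (k * (C / c)))) * norm f" by (simp add: ring_distribs)
    finally show ?thesis by (simp add: f_def)
  qed
  then show ?thesis by blast
qed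

lemma shiftX_surj:
  assumes \<zeta>: "Re \<zeta> \<ge> 0"
  shows "\<exists>u\<in>dom A. shiftX \<zeta> \<alpha> u = f"
proof -
  obtain v where "Q f = shiftY \<zeta> \<alpha> v" "v \<in> dom A \<inter> Y"
    by (rule imageE[OF subsetD[OF shiftY_surj[OF \<zeta>, of \<alpha>] Q_in_Y[of f]]])
  then have v: "v \<in> dom A" "v \<in> Y" "shiftY \<zeta> \<alpha> v = Q f" by auto
  define g where "g = P f - (\<i> * complex_of_real \<alpha>) *\<^sub>C P (\<Lambda> \<cdot> v)"
  obtain w where w: "w \<in> dom A" "shiftA \<zeta> w = g" using shiftA_surj[OF \<zeta>] by blast
  have gN: "g \<in> N" unfolding g_def by (intro N_sub(3) N_sub(5) P_in_N)
  \<comment> \<open>\<open>shiftA_surj\<close> gives \<open>w\<close> only in \<open>dom A\<close>.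
    As \<open>g\<close> lies in \<open>N\<close>, injectivity of \<open>shiftA\<close> forces
    \<open>w\<close> to agree with \<open>P w\<close>.\<close>
  have "shiftA \<zeta> (w - P w) = 0"
    using P_shiftA[OF w(1), of \<zeta>] gN w by (simp add: shiftA_diff P_A)
  then have "w - P w = 0"
    using shiftA_bound[OF A_sub(3)[OF w(1) P_A(1)[OF w(1)]] \<zeta>] by simp
  then have wN: "w \<in> N" using P_in_N[of w] by simp
  have "shiftX \<zeta> \<alpha> (v + w) = shiftA \<zeta> v + shiftA \<zeta> w + (\<i> * complex_of_real \<alpha>) *\<^sub>C (\<Lambda> \<cdot> v)"
    using v w wN by (simp add: shiftX_shiftA shiftA_add \<Lambda>_add)
  also have "\<Lambda> \<cdot> v = Q (\<Lambda> \<cdot> v) + P (\<Lambda> \<cdot> v)" by (simp add: Q_plus_P)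
  also have "shiftA \<zeta> v + shiftA \<zeta> w + (\<i> * complex_of_real \<alpha>) *\<^sub>C (Q (\<Lambda> \<cdot> v) + P (\<Lambda> \<cdot> v))
      = shiftY \<zeta> \<alpha> v + P f"
    by (simp add: shiftY_shiftA w g_def scaleC_add_right)
  also have "\<dots> = f" using v by (simp add: Q_plus_P)
  finally show ?thesis using A_sub(2)[OF v(1) w(1)] by blast
qed

lemma shiftX_inj: "Re \<zeta> \<ge> 0 \<Longrightarrow> inj_on (shiftX \<zeta> \<alpha>) (dom A)"
proof (rule inj_onI)
  fix u v assume \<zeta>: "Re \<zeta> \<ge> 0" and uv: "u \<in> dom A" "v \<in> dom A" "shiftX \<zeta> \<alpha> u = shiftX \<zeta> \<alpha> v"
  obtain K where K: "\<And>u. u \<in> dom A \<Longrightarrow> norm u \<le> K * norm (shiftX \<zeta> \<alpha> u)"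
    using shiftX_bound[OF \<zeta>] by blast
  from K[OF A_sub(3)[OF uv(1,2)]] show "u = v" using uv by (simp add: shiftX_diff)
qed

section \<open>Resolvent sets\<close>

lemma L_op_shift: "u \<in> dom A \<Longrightarrow> \<zeta> *\<^sub>C u - L_op A \<Lambda> \<alpha> \<cdot> u = shiftX \<zeta> \<alpha> u"
  by (simp add: L_op_def shiftX_def)

lemma QL_op_eq: "QL_op A \<Lambda> \<alpha> = op_on (dom A \<inter> Y)
    (\<lambda>u. Q (A \<cdot> u) - (\<i> * complex_of_real \<alpha>) *\<^sub>C Q (\<Lambda> \<cdot> u))"
  by (simp add: QL_op_def Let_def Y_def[symmetric] Q_def[symmetric])

lemma QL_op_shift: "u \<in> dom A \<inter> Y \<Longrightarrow> \<zeta> *\<^sub>C u - QL_op A \<Lambda> \<alpha> \<cdot> u = shiftY \<zeta> \<alpha> u"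
  using A_in_Y[of u] by (simp add: QL_op_eq shiftY_def)

lemma resolvent_L:
  assumes \<zeta>: "Re \<zeta> \<ge> 0"
  shows "\<zeta> \<in> resolvent_set_in UNIV (L_op A \<Lambda> \<alpha>)"
proof -
  have d: "dom (L_op A \<Lambda> \<alpha>) = dom A" by (simp add: L_op_def)
  have "bij_betw (\<lambda>u. \<zeta> *\<^sub>C u - L_op A \<Lambda> \<alpha> \<cdot> u) (dom A) UNIV
      = bij_betw (shiftX \<zeta> \<alpha>) (dom A) UNIV"
    by (rule bij_betw_cong) (rule L_op_shift)
  moreover have "shiftX \<zeta> \<alpha> ` dom A = UNIV" using shiftX_surj[OF \<zeta>, of \<alpha>] by (auto, metis imageI)
  ultimately show ?thesis
    using shiftX_bound[OF \<zeta>, of \<alpha>] shiftX_inj[OF \<zeta>, of \<alpha>]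
    by (simp add: resolvent_set_in_def d bij_betw_def L_op_shift)
qed

lemma resolvent_QL:
  assumes \<zeta>: "Re \<zeta> \<ge> 0"
  shows "\<zeta> \<in> resolvent_set_in Y (QL_op A \<Lambda> \<alpha>)"
proof -
  have d: "dom (QL_op A \<Lambda> \<alpha>) = dom A \<inter> Y" by (simp add: QL_op_eq)
  have "bij_betw (\<lambda>u. \<zeta> *\<^sub>C u - QL_op A \<Lambda> \<alpha> \<cdot> u) (dom A \<inter> Y) Y
      = bij_betw (shiftY \<zeta> \<alpha>) (dom A \<inter> Y) Y"
    by (rule bij_betw_cong) (rule QL_op_shift)
  moreover have "shiftY \<zeta> \<alpha> ` (dom A \<inter> Y) = Y"
    using shiftY_surj[OF \<zeta>, of \<alpha>] shiftY_in_Y by (intro equalityI image_subsetI) auto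
  moreover have "\<exists>K. \<forall>u\<in>dom A \<inter> Y. norm u \<le> K * norm (\<zeta> *\<^sub>C u - QL_op A \<Lambda> \<alpha> \<cdot> u)"
    using shiftY_bound[OF _ \<zeta>, of _ \<alpha>] by (intro exI[of _ "C / c"]) (simp add: QL_op_shift)
  ultimately show ?thesis
    using shiftY_inj[OF \<zeta>, of \<alpha>]
    by (simp add: resolvent_set_in_def d bij_betw_def)
qed

section \<open>Resolvents on the imaginary axis\<close>

abbreviation resX :: "real \<Rightarrow> real \<Rightarrow> 'a \<Rightarrow> 'a" where
  "resX \<alpha> lam \<equiv> op_inverse (op_shift (\<i> * complex_of_real lam) (L_op A \<Lambda> \<alpha>))"

abbreviation resY :: "real \<Rightarrow> real \<Rightarrow> 'a \<Rightarrow> 'a" where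
  "resY \<alpha> lam \<equiv> op_inverse (op_shift (\<i> * complex_of_real lam) (QL_op A \<Lambda> \<alpha>))"

text \<open>\<open>op_shift\<close> adds the operator to its parameter while \<open>shiftX\<close>
  subtracts it, so the parameter becomes \<open>- (\<i> * complex_of_real lam)\<close> and the right
  hand side changes sign.\<close>

lemma resX: "resX \<alpha> lam f \<in> dom A" "shiftX (- (\<i> * complex_of_real lam)) \<alpha> (resX \<alpha> lam f) = - f"
proof -
  let ?T = "op_shift (\<i> * complex_of_real lam) (L_op A \<Lambda> \<alpha>)"
  have d: "dom ?T = dom A" by (simp add: op_shift_def L_op_def)
  have eq: "?T \<cdot> u = - shiftX (- (\<i> * complex_of_real lam)) \<alpha> u" if "u \<in> dom A" for u
    using that by (simp add: op_shift_def L_op_def shiftX_def)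
  obtain u where "u \<in> dom A" "shiftX (- (\<i> * complex_of_real lam)) \<alpha> u = - f"
    using shiftX_surj[of "- (\<i> * complex_of_real lam)" \<alpha> "- f"] by auto
  then have "f \<in> (\<lambda>u. ?T \<cdot> u) ` dom ?T"
    by (intro image_eqI[of _ _ u]) (auto simp: eq d)
  from inv_into_into[OF this] f_inv_into_f[OF this]
  have *: "resX \<alpha> lam f \<in> dom A" "?T \<cdot> resX \<alpha> lam f = f" by (simp_all add: op_inverse_def d)
  then show "resX \<alpha> lam f \<in> dom A" by simp
  show "shiftX (- (\<i> * complex_of_real lam)) \<alpha> (resX \<alpha> lam f) = - f"
    using *(2) unfolding eq[OF *(1)] by (simp add: minus_equation_iff)
qed

lemma resY:
  assumes f: "f \<in> Y"
  shows "resY \<alpha> lam f \<in> dom A \<inter> Y" "shiftY (- (\<i> * complex_of_real lam)) \<alpha> (resY \<alpha> lam f) = - f"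
proof -
  let ?T = "op_shift (\<i> * complex_of_real lam) (QL_op A \<Lambda> \<alpha>)"
  have d: "dom ?T = dom A \<inter> Y" by (simp add: op_shift_def QL_op_eq)
  have eq: "?T \<cdot> u = - shiftY (- (\<i> * complex_of_real lam)) \<alpha> u" if "u \<in> dom A \<inter> Y" for u
    using that A_in_Y[of u] by (simp add: op_shift_def QL_op_eq shiftY_def)
  have "- f \<in> shiftY (- (\<i> * complex_of_real lam)) \<alpha> ` (dom A \<inter> Y)"
    by (rule subsetD[OF shiftY_surj Y_sub(4)[OF f]]) simp
  then obtain u where "- f = shiftY (- (\<i> * complex_of_real lam)) \<alpha> u" "u \<in> dom A \<inter> Y"
    by (rule imageE)
  then have "f \<in> (\<lambda>u. ?T \<cdot> u) ` dom ?T"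
    by (intro image_eqI[of _ _ u]) (simp_all only: eq d minus_minus minus_equation_iff[of f])
  from inv_into_into[OF this] f_inv_into_f[OF this]
  have *: "resY \<alpha> lam f \<in> dom A \<inter> Y" "?T \<cdot> resY \<alpha> lam f = f" by (simp_all add: op_inverse_def d)
  then show "resY \<alpha> lam f \<in> dom A \<inter> Y" by simp
  show "shiftY (- (\<i> * complex_of_real lam)) \<alpha> (resY \<alpha> lam f) = - f"
    using *(2) unfolding eq[OF *(1)] by (simp add: minus_equation_iff)
qed

lemma Q_resX: "Q (resX \<alpha> lam f) = resY \<alpha> lam (Q f)"
proof (rule inj_onD[OF shiftY_inj])
  let ?\<zeta> = "- (\<i> * complex_of_real lam)"
  show "0 \<le> Re ?\<zeta>" by simp
  show "shiftY ?\<zeta> \<alpha> (Q (resX \<alpha> lam f)) = shiftY ?\<zeta> \<alpha> (resY \<alpha> lam (Q f))"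
    by (simp add: Q_shiftX[OF resX(1), symmetric] resX resY Q_in_Y Q_minus)
qed (use Q_A[OF resX(1)] Q_in_Y resY in auto)

lemma resY_bound:
  assumes f: "f \<in> Y"
  shows "norm (resY \<alpha> lam f) \<le> C / c * norm f"
  using shiftY_bound[OF resY(1)[OF f, of lam \<alpha>], of "- (\<i> * complex_of_real lam)" \<alpha>]
    resY(2)[OF f, of lam \<alpha>] by simp

text \<open>By \<open>Q_resX\<close> the left quotient at \<open>f\<close> is at most the right one
  at \<open>Q f\<close>, since projecting shrinks the denominator; for \<open>f\<close> in
  \<open>Y\<close> the two agree.\<close>

lemma onorm_Q_resX: "onorm (\<lambda>f. Q (resX \<alpha> lam f)) = onorm_in Y (resY \<alpha> lam)"
proof -
  let ?r = "\<lambda>f. norm (resY \<alpha> lam f) / norm f"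
  \<comment> \<open>The uniform bound makes both suprema those of bounded sets; at 0 the quotient
    has the default value 0.\<close>
  have r_le: "?r f \<le> C / c" if "f \<in> Y" for f
    using resY_bound[OF that, of lam \<alpha>] c_pos C_pos by (cases "f = 0") (auto simp: field_simps)
  have bY: "bdd_above (?r ` Y)" using r_le by (intro bdd_aboveI[of _ "C / c"]) auto
  have Q_le: "norm (Q (resX \<alpha> lam f)) / norm f \<le> ?r (Q f)" for f
  proof (cases "Q f = 0")
    case True
    have "resY \<alpha> lam 0 = 0" using resY_bound[OF Y_sub(1), of lam \<alpha>] by simp
    then show ?thesis by (simp add: Q_resX True)
  next
    case False
    then show ?thesis
      unfolding Q_resX using norm_Q_le[of f] by (intro divide_left_mono) (auto simp: zero_less_mult_iff)
  qed
  have bX: "bdd_above (range (\<lambda>f. norm (Q (resX \<alpha> lam f)) / norm f))"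
    using order_trans[OF Q_le r_le[OF Q_in_Y]] by (intro bdd_aboveI[of _ "C / c"]) auto
  have "(SUP f. norm (Q (resX \<alpha> lam f)) / norm f) = (SUP f\<in>Y. ?r f)"
  proof (rule antisym)
    show "(SUP f. norm (Q (resX \<alpha> lam f)) / norm f) \<le> (SUP f\<in>Y. ?r f)"
      by (intro cSUP_least order_trans[OF Q_le] cSUP_upper bY Q_in_Y) auto
    show "(SUP f\<in>Y. ?r f) \<le> (SUP f. norm (Q (resX \<alpha> lam f)) / norm f)"
    proof (rule cSUP_least)
      show "Y \<noteq> {}" using Y_sub(1) by auto
      fix f assume "f \<in> Y"
      then have "?r f = norm (Q (resX \<alpha> lam f)) / norm f" by (simp add: Q_resX)
      also have "\<dots> \<le> (SUP f. norm (Q (resX \<alpha> lam f)) / norm f)" by (rule cSUP_upper[OF UNIV_I bX])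
      finally show "?r f \<le> (SUP f. norm (Q (resX \<alpha> lam f)) / norm f)" .
    qed
  qed
  then show ?thesis by (simp add: onorm_def onorm_in_def)
qed

lemma onorm_in_resY_le:
  assumes "\<And>f. f \<in> Y \<Longrightarrow> norm (resY \<alpha> lam f) \<le> K * norm f" "K \<ge> 0"
  shows "onorm_in Y (resY \<alpha> lam) \<le> K"
  unfolding onorm_in_def
proof (rule cSUP_least)
  show "Y \<noteq> {}" using Y_sub(1) by auto
  fix f assume "f \<in> Y"
  with assms show "norm (resY \<alpha> lam f) / norm f \<le> K"
    by (cases "f = 0") (auto simp: divide_le_eq)
qed

text \<open>On the kernel of \<open>\<Lambda>\<close> the operator \<open>A\<close> is bounded, so for large \<open>\<bar>\<alpha>\<bar>\<close> the term \<open>\<i> lam P U\<close>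
  dominates \<open>A P U\<close> in the kernel component of the resolvent equation for \<open>U = resX \<alpha> lam f\<close>.
  This controls \<open>P U\<close> by \<open>Q U\<close>.\<close>

lemma resX_energy:
  assumes t: "t > 0"
  shows "\<exists>M>0. \<exists>K>0. \<forall>\<alpha> lam f. M \<le> \<bar>\<alpha>\<bar> \<longrightarrow> t * \<bar>\<alpha>\<bar> \<le> \<bar>lam\<bar> \<longrightarrow> f \<in> Y \<longrightarrow>
    (norm (S \<cdot> resX \<alpha> lam f))\<^sup>2 \<le> K * norm f * norm (resX \<alpha> lam f)"
proof -
  obtain k where k: "k \<ge> 0" "\<And>u. u \<in> dom A \<Longrightarrow> norm (P (\<Lambda> \<cdot> u)) \<le> k * norm u"
    using PL_bounded by blast
  obtain a where a: "a \<ge> 0" "\<And>u. u \<in> N \<Longrightarrow> norm (A \<cdot> u) \<le> a * norm u"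
    using A_bounded_on_N by blast
  \<comment> \<open>Ensures \<open>2 * a \<le> t * \<bar>\<alpha>\<bar>\<close>, hence
    \<open>A \<cdot> w\<close> takes at most half of \<open>\<bar>lam\<bar> * norm w\<close>; the
    added 1 keeps \<open>M\<close> positive when \<open>a = 0\<close>.\<close>
  define M where "M = 2 * a / t + 1"
  \<comment> \<open>\<open>2 * k / t\<close> bounds the ratio of \<open>norm w\<close> to
    \<open>norm u\<close> obtained below, and \<open>C / c\<close> is the constant of
    \<open>shiftY_energy\<close>.\<close>
  define K where "K = (1 + a * (2 * k / t)\<^sup>2) * (C / c)"
  have "(norm (S \<cdot> resX \<alpha> lam f))\<^sup>2 \<le> K * norm f * norm (resX \<alpha> lam f)"
    if \<alpha>: "M \<le> \<bar>\<alpha>\<bar>" and lam: "t * \<bar>\<alpha>\<bar> \<le> \<bar>lam\<bar>" and f: "f \<in> Y" for \<alpha> lam f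
  proof -
    let ?\<zeta> = "- (\<i> * complex_of_real lam)"
    define U u w where "U = resX \<alpha> lam f" and "u = Q U" and "w = P U"
    have U: "U \<in> dom A" "shiftX ?\<zeta> \<alpha> U = - f" using resX by (simp_all add: U_def)
    have u: "u \<in> dom A" "u \<in> Y" using Q_A[OF U(1)] Q_in_Y by (auto simp: u_def)
    have w: "w \<in> dom A" "w \<in> N" using P_A[OF U(1)] P_in_N by (auto simp: w_def)
    have Uuw: "U = u + w" by (simp add: u_def w_def Q_plus_P)
    have "shiftA ?\<zeta> w + (\<i> * complex_of_real \<alpha>) *\<^sub>C P (\<Lambda> \<cdot> u) = 0"
      using P_shiftX[OF U(1), of ?\<zeta> \<alpha>] Y_sub(4)[OF f] by (simp add: U(2) u_def w_def)
    then have "(\<i> * complex_of_real lam) *\<^sub>C w = (\<i> * complex_of_real \<alpha>) *\<^sub>C P (\<Lambda> \<cdot> u) - A \<cdot> w"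
      by (simp add: shiftA_def algebra_simps add_eq_0_iff2)
    then have "norm ((\<i> * complex_of_real lam) *\<^sub>C w) \<le> norm ((\<i> * complex_of_real \<alpha>) *\<^sub>C P (\<Lambda> \<cdot> u)) + norm (A \<cdot> w)"
      by (simp only:) (rule norm_triangle_ineq4)
    then have "\<bar>lam\<bar> * norm w \<le> \<bar>\<alpha>\<bar> * norm (P (\<Lambda> \<cdot> u)) + norm (A \<cdot> w)" by (simp add: norm_mult)
    also have "\<dots> \<le> \<bar>\<alpha>\<bar> * (k * norm u) + a * norm w"
      using k(2)[OF u(1)] a(2)[OF w(2)] by (intro add_mono mult_left_mono) auto
    finally have 1: "\<bar>lam\<bar> * norm w \<le> \<bar>\<alpha>\<bar> * (k * norm u) + a * norm w" .
    have "2 * a \<le> t * \<bar>\<alpha>\<bar>" using \<alpha> t by (simp add: M_def field_simps)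
    then have "(2 * a) * norm w \<le> (t * \<bar>\<alpha>\<bar>) * norm w" by (rule mult_right_mono) simp
    moreover have "(t * \<bar>\<alpha>\<bar>) * norm w \<le> \<bar>lam\<bar> * norm w" by (rule mult_right_mono[OF lam]) simp
    ultimately have "(t * \<bar>\<alpha>\<bar>) * norm w \<le> 2 * (\<bar>\<alpha>\<bar> * (k * norm u))" using 1 by linarith
    then have "\<bar>\<alpha>\<bar> * (t * norm w) \<le> \<bar>\<alpha>\<bar> * (2 * k * norm u)" by (simp add: algebra_simps)
    moreover have \<alpha>0: "\<bar>\<alpha>\<bar> > 0" using \<alpha> a(1) t by (simp add: M_def) (smt (verit) divide_nonneg_pos)
    ultimately have "t * norm w \<le> 2 * k * norm u" by (simp only: mult_le_cancel_left_pos)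
    then have w_le: "norm w \<le> (2 * k / t) * norm u" using t by (simp add: field_simps)
    have "(norm (S \<cdot> w))\<^sup>2 \<le> cmod \<langle>- (A \<cdot> w), w\<rangle>"
      unfolding S_norm[OF w(1)] by (rule complex_Re_le_cmod)
    also have "\<dots> \<le> norm (A \<cdot> w) * norm w" using cmod_cinner_le[of "- (A \<cdot> w)" w] by simp
    also have "\<dots> \<le> a * (norm w)\<^sup>2"
      using mult_right_mono[OF a(2)[OF w(2)], of "norm w"] by (simp add: power2_eq_square mult.assoc)
    also have "\<dots> \<le> a * ((2 * k / t) * norm u)\<^sup>2"
      using w_le a(1) by (intro mult_left_mono power_mono) auto
    also have "\<dots> \<le> a * ((2 * k / t) * norm (S \<cdot> u))\<^sup>2"
      using norm_le_S[OF u(1)] a(1) k(1) t by (intro mult_left_mono power_mono) auto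
    finally have Sw: "(norm (S \<cdot> w))\<^sup>2 \<le> a * (2 * k / t)\<^sup>2 * (norm (S \<cdot> u))\<^sup>2"
      by (simp only: power_mult_distrib mult.assoc)
    \<comment> \<open>\<open>A\<close> leaves \<open>Y\<close> and \<open>N\<close> invariant, so
      the mixed terms of the quadratic form vanish.\<close>
    have "(norm (S \<cdot> U))\<^sup>2 = (norm (S \<cdot> u))\<^sup>2 + (norm (S \<cdot> w))\<^sup>2"
    proof -
      have "\<langle>A \<cdot> u, w\<rangle> = 0" "\<langle>A \<cdot> w, u\<rangle> = 0"
        using Y_orth A_in_Y[OF u] A_in_N[OF w(2)] u w by auto
      then show ?thesis
        by (simp add: S_norm U u w Uuw[symmetric]) (simp add: Uuw A_add u w cinner_add_left cinner_add_right)
    qed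
    also have "\<dots> \<le> (1 + a * (2 * k / t)\<^sup>2) * (norm (S \<cdot> u))\<^sup>2"
      using Sw by (simp only: distrib_right mult_1)
    also have "\<dots> \<le> (1 + a * (2 * k / t)\<^sup>2) * (C / c * norm f * norm u)"
    proof (rule mult_left_mono)
      have "shiftY ?\<zeta> \<alpha> u = - f"
        using Q_shiftX[OF U(1), of ?\<zeta> \<alpha>] Y_sub(4)[OF f] by (simp add: U(2) u_def)
      then show "(norm (S \<cdot> u))\<^sup>2 \<le> C / c * norm f * norm u"
        using shiftY_energy[of u ?\<zeta> \<alpha>] u by simp
    qed (use a in simp)
    also have "\<dots> = K * norm f * norm u" by (simp add: K_def)
    also have "\<dots> \<le> K * norm f * norm U"
      using norm_Q_le[of U] a(1) c_pos C_pos by (intro mult_left_mono) (auto simp: u_def K_def)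
    finally show ?thesis by (simp add: U_def)
  qed
  moreover have "M > 0" using a(1) t by (simp add: M_def add_nonneg_pos)
  moreover have "K > 0" using a(1) c_pos C_pos by (simp add: K_def add_pos_nonneg)
  ultimately show ?thesis by blast
qed

section \<open>The estimate for large \<open>\<bar>\<alpha>\<bar>\<close>\<close>

text \<open>In the pairing of \<open>f\<close> with \<open>v\<close> the second summand contributes
  \<open>\<alpha> * (norm v)\<^sup>2\<close> to the imaginary part, and \<open>e\<close> controls
  the contribution of the first.\<close>

lemma defect_bound:
  assumes "f = a + (\<i> * complex_of_real \<alpha>) *\<^sub>C v" "\<bar>Im \<langle>a, v\<rangle>\<bar> \<le> e"
  shows "\<bar>\<alpha>\<bar> * (norm v)\<^sup>2 \<le> norm f * norm v + e"
proof -
  have "Im \<langle>f, v\<rangle> = Im \<langle>a, v\<rangle> + \<alpha> * (norm v)\<^sup>2"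
    by (simp add: assms cinner_add_left cinner_scaleC_left cinner_self del: of_real_power)
  moreover have "\<bar>Im \<langle>f, v\<rangle>\<bar> \<le> norm f * norm v"
    by (rule order_trans[OF abs_Im_le_cmod cmod_cinner_le])
  moreover have "\<bar>\<alpha>\<bar> * (norm v)\<^sup>2 = \<bar>\<alpha> * (norm v)\<^sup>2\<bar>" by (simp add: abs_mult)
  ultimately show ?thesis using assms(2) by linarith
qed

lemma Im_cinner_A: "u \<in> dom A \<Longrightarrow> Im \<langle>A \<cdot> u, u\<rangle> = 0"
  using arg_cong[OF self_adjoint_symmetric[OF A_self_adjoint, of u u], of Im]
    arg_cong[OF cinner_commute[of "A \<cdot> u" u], of Im] by simp

text \<open>For \<open>\<mu>\<close> beyond the threshold the hypotheses are applied to the solution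
  \<open>U\<close> in the whole space, whose projection is the solution in \<open>Y\<close>;
  otherwise to the solution in \<open>Y\<close> directly. Either way
  \<open>resolvent_arithmetic\<close> concludes for fixed \<open>m1\<close> and \<open>m2\<close>,
  and the infimum is taken last.\<close>

lemma resolvent_estimate:
  fixes B3 :: "'a operator" and h1 h2 :: "real \<Rightarrow> real \<Rightarrow> real" and \<tau> :: ereal
    and m0 C' :: real
  assumes C': "C' > 0" and \<tau>: "\<tau> > 0" and m0: "m0 \<ge> 0"
    and h1_nonneg: "\<And>m \<mu>. m0 \<le> m \<Longrightarrow> 0 \<le> h1 m \<mu>"
    and h2_nonneg: "\<And>m \<mu>. m0 \<le> m \<Longrightarrow> 0 \<le> h2 m \<mu>"
    and u_far: "\<And>\<mu> m u. m \<ge> m0 \<Longrightarrow> ereal \<bar>\<mu>\<bar> \<ge> \<tau> \<Longrightarrow> u \<in> dom A \<Longrightarrow>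
           (norm u)\<^sup>2 \<le> C' * (m\<^sup>2 * (norm (\<mu> *\<^sub>R u - \<Lambda> \<cdot> u))\<^sup>2 + (h1 m \<mu>)\<^sup>2 * (norm (S \<cdot> u))\<^sup>2)"
    and u_near: "\<And>\<mu> m u. m \<ge> m0 \<Longrightarrow> ereal \<bar>\<mu>\<bar> < \<tau> \<Longrightarrow> u \<in> dom A \<inter> Y \<Longrightarrow>
           (norm u)\<^sup>2 \<le> C' * (m\<^sup>2 * (norm (Q (\<mu> *\<^sub>R u - \<Lambda> \<cdot> u)))\<^sup>2 + (h1 m \<mu>)\<^sup>2 * (norm (S \<cdot> u))\<^sup>2)"
    and commutator: "\<And>u. u \<in> dom A \<Longrightarrow> \<bar>Im \<langle>A \<cdot> u, \<Lambda> \<cdot> u\<rangle>\<bar> \<le> C' * norm (S \<cdot> u) * norm (B3 \<cdot> u)"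
    and B3_far: "\<And>\<mu> m u. m \<ge> m0 \<Longrightarrow> ereal \<bar>\<mu>\<bar> \<ge> \<tau> \<Longrightarrow> u \<in> dom A \<Longrightarrow>
           (norm (B3 \<cdot> u))\<^sup>2 \<le> C' * (m\<^sup>2 * (norm (\<mu> *\<^sub>R u - \<Lambda> \<cdot> u))\<^sup>2 + (h2 m \<mu>)\<^sup>2 * (norm (S \<cdot> u))\<^sup>2)"
    and B3_near: "\<And>\<mu> m u. m \<ge> m0 \<Longrightarrow> ereal \<bar>\<mu>\<bar> < \<tau> \<Longrightarrow> u \<in> dom A \<inter> Y \<Longrightarrow>
           (norm (B3 \<cdot> u))\<^sup>2 \<le> C' * (m\<^sup>2 * (norm (Q (\<mu> *\<^sub>R u - \<Lambda> \<cdot> u)))\<^sup>2 + (h2 m \<mu>)\<^sup>2 * (norm (S \<cdot> u))\<^sup>2)"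
  shows "\<exists>M0>0. \<exists>M>0. \<forall>\<alpha> lam. \<bar>\<alpha>\<bar> \<ge> M0 \<longrightarrow>
    onorm_in Y (resY \<alpha> lam) \<le> M * F_bound m0 h1 h2 \<alpha> (lam / \<alpha>)"
proof -
  \<comment> \<open>\<open>resX_energy\<close> asks for a real threshold. For
    \<open>\<tau> = \<infinity>\<close> no \<open>\<mu>\<close> satisfies the premise, so 1 serves
    as well as any positive number.\<close>
  obtain t where t: "t > 0" "\<And>\<mu>. \<tau> \<le> ereal \<bar>\<mu>\<bar> \<Longrightarrow> t \<le> \<bar>\<mu>\<bar>"
  proof (cases \<tau>)
    case (real r)
    then show ?thesis using that[of r] \<tau> by simp
  qed (use that[of 1] \<tau> in auto)
  obtain M0 K where M0: "M0 > 0" and K: "K > 0" and far: "\<And>\<alpha> lam f. M0 \<le> \<bar>\<alpha>\<bar> \<Longrightarrow> t * \<bar>\<alpha>\<bar> \<le> \<bar>lam\<bar> \<Longrightarrow> f \<in> Y \<Longrightarrow>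
    (norm (S \<cdot> resX \<alpha> lam f))\<^sup>2 \<le> K * norm f * norm (resX \<alpha> lam f)"
    using resX_energy[OF t(1)] by blast
  \<comment> \<open>One constant for both regimes: \<open>K\<close> comes from
    \<open>resX_energy\<close>, \<open>C / c\<close> from \<open>shiftY_energy\<close>.\<close>
  define K' where "K' = K + C / c"
  have K': "K' > 0" "K \<le> K'" "C / c \<le> K'" using K c_pos C_pos by (auto simp: K'_def add_pos_pos)
  define D where "D = C' * sqrt C'"
  define M where "M = C' * (2 * D\<^sup>2 + 2 * D + 1) * K' + 2 * sqrt C'"
  have M: "M > 0" using C' K' by (simp add: M_def D_def add_nonneg_pos)
  let ?E = "\<lambda>\<alpha> \<mu> m1 m2. m1 / \<bar>\<alpha>\<bar> + m1\<^sup>2 * m2\<^sup>2 / \<alpha>\<^sup>2 + m1\<^sup>2 * h2 m2 \<mu> / \<bar>\<alpha>\<bar> + (h1 m1 \<mu>)\<^sup>2"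
  have main: "norm (resY \<alpha> lam f) \<le> M * ?E \<alpha> (lam / \<alpha>) m1 m2 * norm f"
    if \<alpha>: "M0 \<le> \<bar>\<alpha>\<bar>" and m: "m0 \<le> m1" "m0 \<le> m2" and f: "f \<in> Y" for \<alpha> lam f m1 m2
  proof -
    define \<mu> where "\<mu> = lam / \<alpha>"
    let ?\<zeta> = "- (\<i> * complex_of_real lam)"
    have \<alpha>0: "\<alpha> \<noteq> 0" using \<alpha> M0 by auto
    then have lam: "lam = \<alpha> * \<mu>" by (simp add: \<mu>_def)
    have arith: "n \<le> M * ?E \<alpha> \<mu> m1 m2 * norm f"
      if "0 \<le> n" "0 \<le> d" "0 \<le> s" "0 \<le> b" "\<bar>\<alpha>\<bar> * d\<^sup>2 \<le> norm f * d + C' * s * b"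
        "n\<^sup>2 \<le> C' * (m1\<^sup>2 * d\<^sup>2 + (h1 m1 \<mu>)\<^sup>2 * s\<^sup>2)" "b\<^sup>2 \<le> C' * (m2\<^sup>2 * d\<^sup>2 + (h2 m2 \<mu>)\<^sup>2 * s\<^sup>2)"
        "s\<^sup>2 \<le> K' * norm f * n" for n d s b
      using resolvent_arithmetic[of "\<bar>\<alpha>\<bar>" n d s b "norm f" m1 m2 "h1 m1 \<mu>" "h2 m2 \<mu>" C' K' D M]
        that \<alpha>0 m m0 h1_nonneg[OF m(1)] h2_nonneg[OF m(2)] C' K' D_def M_def by simp
    show ?thesis
    proof (cases "\<tau> \<le> ereal \<bar>\<mu>\<bar>")
      case True
      define U v where "U = resX \<alpha> lam f" and "v = \<mu> *\<^sub>R U - \<Lambda> \<cdot> U"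
      have U: "U \<in> dom A" "shiftX ?\<zeta> \<alpha> U = - f" using resX by (simp_all add: U_def)
      have f_eq: "f = A \<cdot> U + (\<i> * complex_of_real \<alpha>) *\<^sub>C v"
      proof -
        have "f = - shiftX ?\<zeta> \<alpha> U" using U(2) by simp
        also have "\<dots> = A \<cdot> U + (\<i> * complex_of_real \<alpha>) *\<^sub>C v"
          by (simp add: shiftX_def v_def scaleR_eq_scaleC scaleC_diff_right scaleC_scaleC lam mult.assoc)
        finally show ?thesis .
      qed
      \<comment> \<open>Only the part with \<open>\<Lambda>\<close> contributes, because
        \<open>\<langle>A \<cdot> U, U\<rangle>\<close> and \<open>\<mu>\<close> are real.\<close>
      have "\<bar>Im \<langle>A \<cdot> U, v\<rangle>\<bar> \<le> C' * norm (S \<cdot> U) * norm (B3 \<cdot> U)"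
        using commutator[OF U(1)] Im_cinner_A[OF U(1)]
        by (simp add: v_def cinner_diff_right scaleR_eq_scaleC cinner_scaleC_right)
      note d = defect_bound[OF f_eq this]
      have "t * \<bar>\<alpha>\<bar> \<le> \<bar>lam\<bar>" using mult_right_mono[OF t(2)[OF True], of "\<bar>\<alpha>\<bar>"] by (simp add: lam abs_mult mult.commute)
      from far[OF \<alpha> this f] have "(norm (S \<cdot> U))\<^sup>2 \<le> K * norm f * norm U" by (simp add: U_def)
      also have "\<dots> \<le> K' * norm f * norm U" using K' by (intro mult_right_mono) auto
      finally have "norm U \<le> M * ?E \<alpha> \<mu> m1 m2 * norm f"
        using arith[OF _ _ _ _ d] u_far[OF m(1) True U(1)] B3_far[OF m(2) True U(1)] by (simp add: v_def)
      moreover have "resY \<alpha> lam f = Q U" using Q_resX[of lam \<alpha> f] f by (simp add: U_def)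
      ultimately show ?thesis using norm_Q_le[of U] by (simp add: \<mu>_def)
    next
      case False
      then have near: "ereal \<bar>\<mu>\<bar> < \<tau>" by simp
      define u v where "u = resY \<alpha> lam f" and "v = Q (\<mu> *\<^sub>R u - \<Lambda> \<cdot> u)"
      have u: "u \<in> dom A \<inter> Y" "shiftY ?\<zeta> \<alpha> u = - f" using resY[OF f] by (simp_all add: u_def)
      then have uA: "u \<in> dom A" and uY: "u \<in> Y" by auto
      have v: "v = \<mu> *\<^sub>R u - Q (\<Lambda> \<cdot> u)" by (simp add: v_def Q_diff Q_scaleR uY)
      have f_eq: "f = A \<cdot> u + (\<i> * complex_of_real \<alpha>) *\<^sub>C v"
      proof -
        have "f = - shiftY ?\<zeta> \<alpha> u" using u(2) by simp
        also have "\<dots> = A \<cdot> u + (\<i> * complex_of_real \<alpha>) *\<^sub>C v"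
          by (simp add: shiftY_def v scaleR_eq_scaleC scaleC_diff_right scaleC_scaleC lam mult.assoc)
        finally show ?thesis .
      qed
      \<comment> \<open>\<open>A \<cdot> u\<close> lies in \<open>Y\<close>, so \<open>Q\<close>
        drops out of the pairing and the commutator hypothesis applies as in the other case.\<close>
      have "\<bar>Im \<langle>A \<cdot> u, v\<rangle>\<bar> \<le> C' * norm (S \<cdot> u) * norm (B3 \<cdot> u)"
        using commutator[OF uA] Im_cinner_A[OF uA]
        by (simp add: v cinner_diff_right scaleR_eq_scaleC cinner_scaleC_right
            cinner_Q_right[OF A_in_Y[OF uA uY]])
      note d = defect_bound[OF f_eq this]
      have "(norm (S \<cdot> u))\<^sup>2 \<le> C / c * norm f * norm u"
        using shiftY_energy[OF u(1), of ?\<zeta> \<alpha>] by (simp add: u(2))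
      also have "\<dots> \<le> K' * norm f * norm u" using K' by (intro mult_right_mono) auto
      finally have "norm u \<le> M * ?E \<alpha> \<mu> m1 m2 * norm f"
        using arith[OF _ _ _ _ d] u_near[OF m(1) near u(1)] B3_near[OF m(2) near u(1)] by (simp add: v_def)
      then show ?thesis by (simp add: u_def \<mu>_def)
    qed
  qed
  have "onorm_in Y (resY \<alpha> lam) \<le> M * F_bound m0 h1 h2 \<alpha> (lam / \<alpha>)" if \<alpha>: "M0 \<le> \<bar>\<alpha>\<bar>" for \<alpha> lam
  proof -
    have "onorm_in Y (resY \<alpha> lam) / M \<le> F_bound m0 h1 h2 \<alpha> (lam / \<alpha>)"
      unfolding F_bound_def
    proof (rule cINF_greatest)
      show "{m0..} \<times> {m0..} \<noteq> {}" by auto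
      fix q assume "q \<in> {m0..} \<times> {m0..}"
      then obtain m1 m2 where q: "q = (m1, m2)" and m: "m0 \<le> m1" "m0 \<le> m2" by auto
      have "0 \<le> ?E \<alpha> (lam / \<alpha>) m1 m2"
        using m m0 h2_nonneg[OF m(2), of "lam / \<alpha>"] by simp
      then have "onorm_in Y (resY \<alpha> lam) \<le> M * ?E \<alpha> (lam / \<alpha>) m1 m2"
        using main[OF \<alpha> m] M by (intro onorm_in_resY_le) auto
      then show "onorm_in Y (resY \<alpha> lam) / M \<le> (case q of (m1, m2) \<Rightarrow> ?E \<alpha> (lam / \<alpha>) m1 m2)"
        using M by (simp add: q divide_le_eq mult.commute)
    qed
    then show ?thesis using M by (simp add: divide_le_eq mult.commute)
  qed
  with M0 M show ?thesis by blast
qed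

end

theorem theorem2p9:
  fixes A \<Lambda> B1 B2 B3 sqrtA :: "'a::chilbert_space operator"
    and Y :: "'a set" and Q :: "'a \<Rightarrow> 'a"
    and C1 C2 C3 c1 m0 :: real and \<tau> :: ereal
    and h1 h2 :: "real \<Rightarrow> real \<Rightarrow> real"
  assumes Y: "Y = orth_compl (op_ker \<Lambda>)"
    and Q: "Q = orth_proj Y"
    and sqrtA: "sqrtA = op_sqrt (op_uminus A)"
    \<comment> \<open>(1)\<close>
    and "self_adjoint A" and "compact_resolvent A"
    and "\<And>u. u \<in> dom A \<Longrightarrow> Re \<langle>- (A \<cdot> u), u\<rangle> \<ge> (norm u)\<^sup>2"
    \<comment> \<open>(2)(i)\<close>
    and "linear_op \<Lambda>" and "densely_defined \<Lambda>" and "closed_op \<Lambda>"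
    and "relatively_compact_op \<Lambda> (op_uminus A)"
    \<comment> \<open>(2)(ii)\<close>
    and "\<And>u. u \<in> dom A \<Longrightarrow> Q u \<in> dom A \<and> A \<cdot> (Q u) = Q (A \<cdot> u)"
    and "dom A \<subseteq> dom (adjoint_op \<Lambda>)"
    and "C1 > 0"
    and "\<And>u. u \<in> dom A \<Longrightarrow>
           cmod \<langle>\<Lambda> \<cdot> u, u\<rangle> + \<bar>Im \<langle>- (A \<cdot> u), \<Lambda> \<cdot> u\<rangle>\<bar> \<le> C1 * Re \<langle>- (A \<cdot> u), u\<rangle>"
    \<comment> \<open>(2)(iii)\<close>
    and "closed_op B1" and "symmetric_op B1" and "closed_op B2" and "symmetric_op B2"
    and "c1 > 0" and "C2 > 0"
    and "\<Lambda> = B1 \<circ>\<^sub>m B2" and "op_ker \<Lambda> = op_ker B2"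
    and "\<And>u. u \<in> dom A \<Longrightarrow>
           u \<in> dom B2 \<and> (norm (B2 \<cdot> u))\<^sup>2 \<le> C2 * (norm (sqrtA \<cdot> u))\<^sup>2"
    and "\<And>u. u \<in> dom A \<inter> Y \<Longrightarrow>
           Re \<langle>u, B2 \<cdot> u\<rangle> \<ge> c1 * (norm u)\<^sup>2"
    and "\<And>u. u \<in> dom A \<inter> Y \<Longrightarrow>
           Re \<langle>- (A \<cdot> u), B2 \<cdot> u\<rangle> \<ge> c1 * (norm (sqrtA \<cdot> u))\<^sup>2"
    \<comment> \<open>(3)\<close>
    and "C3 > 0" and "\<tau> > 0" and "m0 \<ge> 1"
    and "admissible_weight m0 h1" and "admissible_weight m0 h2"
    \<comment> \<open>(3)(i)\<close>
    and "op_ker \<Lambda> \<subseteq> dom A"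
    \<comment> \<open>(3)(ii)\<close>
    and "\<And>u. u \<in> dom B2 \<and> norm (B2 \<cdot> u) \<le> C3 * norm u"
    and "\<And>\<mu> m u. m \<ge> m0 \<Longrightarrow> ereal \<bar>\<mu>\<bar> \<ge> \<tau> \<Longrightarrow> u \<in> dom A \<Longrightarrow>
           (norm u)\<^sup>2 \<le> C3 * (m\<^sup>2 * (norm (\<mu> *\<^sub>R u - \<Lambda> \<cdot> u))\<^sup>2
                             + (h1 m \<mu>)\<^sup>2 * (norm (sqrtA \<cdot> u))\<^sup>2)"
    and "\<And>\<mu> m u. m \<ge> m0 \<Longrightarrow> ereal \<bar>\<mu>\<bar> < \<tau> \<Longrightarrow> u \<in> dom A \<inter> Y \<Longrightarrow>
           (norm u)\<^sup>2 \<le> C3 * (m\<^sup>2 * (norm (Q (\<mu> *\<^sub>R u - \<Lambda> \<cdot> u)))\<^sup>2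
                             + (h1 m \<mu>)\<^sup>2 * (norm (sqrtA \<cdot> u))\<^sup>2)"
    \<comment> \<open>(3)(iii)\<close>
    and "linear_op B3" and "densely_defined B3" and "closed_op B3"
    and "dom sqrtA \<subseteq> dom B3"
    and "\<And>u. u \<in> dom A \<Longrightarrow>
           \<bar>Im \<langle>A \<cdot> u, \<Lambda> \<cdot> u\<rangle>\<bar> \<le> C3 * norm (sqrtA \<cdot> u) * norm (B3 \<cdot> u)"
    and "\<And>\<mu> m u. m \<ge> m0 \<Longrightarrow> ereal \<bar>\<mu>\<bar> \<ge> \<tau> \<Longrightarrow> u \<in> dom A \<Longrightarrow>
           (norm (B3 \<cdot> u))\<^sup>2 \<le> C3 * (m\<^sup>2 * (norm (\<mu> *\<^sub>R u - \<Lambda> \<cdot> u))\<^sup>2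
                             + (h2 m \<mu>)\<^sup>2 * (norm (sqrtA \<cdot> u))\<^sup>2)"
    and "\<And>\<mu> m u. m \<ge> m0 \<Longrightarrow> ereal \<bar>\<mu>\<bar> < \<tau> \<Longrightarrow> u \<in> dom A \<inter> Y \<Longrightarrow>
           (norm (B3 \<cdot> u))\<^sup>2 \<le> C3 * (m\<^sup>2 * (norm (Q (\<mu> *\<^sub>R u - \<Lambda> \<cdot> u)))\<^sup>2
                             + (h2 m \<mu>)\<^sup>2 * (norm (sqrtA \<cdot> u))\<^sup>2)"
  shows "(\<forall>\<alpha>. {\<zeta>. Re \<zeta> \<ge> 0} \<subseteq> resolvent_set_in UNIV (L_op A \<Lambda> \<alpha>) \<and>
              {\<zeta>. Re \<zeta> \<ge> 0} \<subseteq> resolvent_set_in Y (QL_op A \<Lambda> \<alpha>)) \<and>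
         (\<exists>M0>0. \<exists>C'>0. \<forall>\<alpha> lam. \<bar>\<alpha>\<bar> \<ge> M0 \<longrightarrow>
            onorm (\<lambda>f. Q (op_inverse (op_shift (\<i> * complex_of_real lam) (L_op A \<Lambda> \<alpha>)) f))
              = onorm_in Y (op_inverse (op_shift (\<i> * complex_of_real lam) (QL_op A \<Lambda> \<alpha>))) \<and>
            onorm_in Y (op_inverse (op_shift (\<i> * complex_of_real lam) (QL_op A \<Lambda> \<alpha>)))
              \<le> C' * F_bound m0 h1 h2 \<alpha> (lam / \<alpha>))"
proof -
  \<comment> \<open>The locale constant \<open>C\<close> becomes \<open>C3\<close>, which bounds
    \<open>B2\<close> on the whole space.\<close>
  interpret dissipative_pair A \<Lambda> B1 B2 sqrtA Y Q c1 C3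
    by unfold_locales (fact assms)+
  have "0 \<le> m0" using assms(28) by simp
  moreover have "\<And>m \<mu>. m0 \<le> m \<Longrightarrow> 0 \<le> h1 m \<mu>" "\<And>m \<mu>. m0 \<le> m \<Longrightarrow> 0 \<le> h2 m \<mu>"
    using assms(29,30) by (auto simp: admissible_weight_def)
  ultimately have "\<exists>M0>0. \<exists>M>0. \<forall>\<alpha> lam. \<bar>\<alpha>\<bar> \<ge> M0 \<longrightarrow>
      onorm_in Y (resY \<alpha> lam) \<le> M * F_bound m0 h1 h2 \<alpha> (lam / \<alpha>)"
    \<comment> \<open>In this order: positivity of \<open>C3\<close> and \<open>\<tau>\<close>, the
      two bounds on \<open>norm u\<close>, the commutator inequality and the two bounds on
      \<open>norm (B3 \<cdot> u)\<close>.\<close>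
    by (rule resolvent_estimate[OF assms(26,27) _ _ _ assms(33,34,39-41)])
  then show ?thesis
    using resolvent_L resolvent_QL by (simp only: onorm_Q_resX) blast
qed

end
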